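(* Let $G$ be a countable amenable residually finite group and $\mathscr A$ a finite discrete space. If $\underline x\in\mathscr A^G$ is a regular Toeplitz configuration, then the system $(\overline{G\underline x},G)$ is uniquely ergodic and has zero topological entropy.
   Context: $G$ acts on $\mathscr A^G$ by the shift $(h,(x_g)_{g\in G})\mapsto(x_{gh})_{g\in G}$; $\overline{G\underline x}$ is the closure of the orbit of $\underline x$. $H<_fG$ means that $H$ is a finite index subgroup of $G$. A group is residually finite if it has a nested sequence of finite index normal subgroups with trivial intersection. $\underline x\in\mathscr A^G$ is a Toeplitz configuration if for every $g\in G$ there is $H<_fG$ such that $\underline x$ is constant on $Hg$, i.e. $\underline x(\gamma g)=\underline x(g)$ for all $\gamma\in H$. For $H\subset G$ and $a\in\mathscr A$ put $\mathrm{Per}_H(\underline x)=\{g\in G:\underline x(g)=\underline x(\gamma g)\ \forall\gamma\in H\}$ and $\mathrm{Per}_H(\underline x,a)=\{g\in G:\underline x(\gamma g)=a\ \forall\gamma\in H\}$. A nested (decreasing) sequence $\{H_n\}_{n\in\mathbb N}$ of finite index subgroups of $G$ is a skeleton of $\underline x$ if $\bigcup_n\mathrm{Per}_{H_n}(\underline x)=G$ and for every $n$: $\mathrm{Per}_{H_n}(\underline x)\neq\emptyset$, and whenever $g\in G$ satisfies $\mathrm{Per}_{H_n}(\underline x,a)=\mathrm{Per}_{H_n}(g\underline x,a)$ for every $a\in\mathscr A$, then $g\in H_n$. Upper Banach density of $A\subset G$: $D^*(A)=\inf_F\sup_{g\in G}|A\cap Fg|/|F|$, the infimum over all non-empty finite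 $F\subset G$. A Toeplitz configuration $\underline x$ is regular if there is a skeleton $\{H_n\}$ of $\underline x$ with $\sup_nD^*(\mathrm{Per}_{H_n}(\underline x))=1$. Uniquely ergodic means there is exactly one $G$-invariant Borel probability measure. Topological entropy of $(Y,G)$: $\sup_{\mathcal U}\lim_n\log\mathcal N(\bigvee_{f\in F_n}f^{-1}\mathcal U)/|F_n|$ over open covers $\mathcal U$, where $\mathcal N$ is the minimal cardinality of a subcover and $\{F_n\}$ is any Følner sequence (non-empty finite sets with $|gF_n\triangle F_n|/|F_n|\to0$ for all $g\in G$).
   Formalization: The group G is assumed to be infinite; for finite G the claim fails, e.g. G = Z/2 and x = (0,1) is a regular Toeplitz configuration whose two-point orbit has entropy (log 2)/2 > 0. *)

theory Defs
  imports "HOL-Algebra.Coset" "HOL-Probability.Probability_Measure"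
begin

section \<open>Groups\<close>

definition finite_index_subgroup :: "'g set \<Rightarrow> ('g, 'b) monoid_scheme \<Rightarrow> bool" where
  "finite_index_subgroup H G \<longleftrightarrow> subgroup H G \<and> finite (rcosets\<^bsub>G\<^esub> H)"

definition residually_finite :: "('g, 'b) monoid_scheme \<Rightarrow> bool" where
  "residually_finite G \<longleftrightarrow>
     (\<exists>N :: nat \<Rightarrow> 'g set. decseq N \<and> (\<forall>n. N n \<lhd> G \<and> finite_index_subgroup (N n) G) \<and>
        (\<Inter>n. N n) = {\<one>\<^bsub>G\<^esub>})"

definition folner_sequence :: "('g, 'b) monoid_scheme \<Rightarrow> (nat \<Rightarrow> 'g set) \<Rightarrow> bool" where
  "folner_sequence G F \<longleftrightarrow>
     (\<forall>n. finite (F n) \<and> F n \<noteq> {} \<and> F n \<subseteq> carrier G) \<and>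
     (\<forall>g\<in>carrier G.
        (\<lambda>n. real (card (sym_diff (g <#\<^bsub>G\<^esub> F n) (F n))) / real (card (F n))) \<longlonglongrightarrow> 0)"

text \<open>Amenability in the sense of Folner. This is meant for countable groups only: for
  uncountable groups one would need nets in place of sequences.\<close>

definition amenable :: "('g, 'b) monoid_scheme \<Rightarrow> bool" where
  "amenable G \<longleftrightarrow> (\<exists>F. folner_sequence G F)"

definition upper_banach_density :: "('g, 'b) monoid_scheme \<Rightarrow> 'g set \<Rightarrow> real" where
  "upper_banach_density G A =
     (INF F\<in>{F. finite F \<and> F \<noteq> {} \<and> F \<subseteq> carrier G}.
        SUP g\<in>carrier G. real (card (A \<inter> (F #>\<^bsub>G\<^esub> g))) / real (card F))"

section \<open>Topological dynamical systems\<close>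

text \<open>A system is given by a topology \<open>Y\<close> on its phase space \<open>topspace Y\<close> and a map
  \<open>T\<close> that sends \<open>g\<close> and \<open>y\<close> to the translate of \<open>y\<close> by \<open>g\<close>.\<close>

definition borel_sigma :: "'y topology \<Rightarrow> 'y measure" where
  "borel_sigma Y = sigma (topspace Y) {U. openin Y U}"

definition invariant_borel_prob ::
    "('g, 'b) monoid_scheme \<Rightarrow> 'y topology \<Rightarrow> ('g \<Rightarrow> 'y \<Rightarrow> 'y) \<Rightarrow> 'y measure \<Rightarrow> bool" where
  "invariant_borel_prob G Y T \<mu> \<longleftrightarrow>
     prob_space \<mu> \<and> sets \<mu> = sets (borel_sigma Y) \<and>
     (\<forall>g\<in>carrier G. \<forall>B\<in>sets \<mu>. emeasure \<mu> {y \<in> topspace Y. T g y \<in> B} = emeasure \<mu> B)"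

definition uniquely_ergodic ::
    "('g, 'b) monoid_scheme \<Rightarrow> 'y topology \<Rightarrow> ('g \<Rightarrow> 'y \<Rightarrow> 'y) \<Rightarrow> bool" where
  "uniquely_ergodic G Y T \<longleftrightarrow> (\<exists>!\<mu>. invariant_borel_prob G Y T \<mu>)"

definition open_cover :: "'y topology \<Rightarrow> 'y set set \<Rightarrow> bool" where
  "open_cover Y \<U> \<longleftrightarrow> (\<forall>U\<in>\<U>. openin Y U) \<and> \<Union>\<U> = topspace Y"

text \<open>The common refinement of the preimages of the cover \<open>\<U>\<close> under \<open>T f\<close> for
  \<open>f \<in> F\<close>: choose a member \<open>u f\<close> of \<open>\<U>\<close> for each \<open>f\<close> and intersect the preimages.\<close>

definition cover_join :: "'y topology \<Rightarrow> ('g \<Rightarrow> 'y \<Rightarrow> 'y) \<Rightarrow> 'g set \<Rightarrow> 'y set set \<Rightarrow> 'y set set" where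
  "cover_join Y T F \<U> = {{y \<in> topspace Y. \<forall>f\<in>F. T f y \<in> u f} | u. u \<in> F \<rightarrow> \<U>}"

text \<open>Meaningful if \<open>\<V>\<close> has a finite subcover, as open covers of compact spaces do.\<close>

definition min_subcover_card :: "'y topology \<Rightarrow> 'y set set \<Rightarrow> nat" where
  "min_subcover_card Y \<V> =
     (LEAST k. \<exists>\<W>\<subseteq>\<V>. finite \<W> \<and> \<Union>\<W> = topspace Y \<and> card \<W> = k)"

text \<open>The entropy computed along the sequence \<open>F\<close>. For actions of infinite amenable groups on
  compact spaces it does not depend on the choice of the Folner sequence \<open>F\<close>.\<close>

definition topological_entropy ::
    "'y topology \<Rightarrow> ('g \<Rightarrow> 'y \<Rightarrow> 'y) \<Rightarrow> (nat \<Rightarrow> 'g set) \<Rightarrow> ereal" where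
  "topological_entropy Y T F =
     (SUP \<U>\<in>{\<U>. open_cover Y \<U>}.
        lim (\<lambda>n. ereal (ln (real (min_subcover_card Y (cover_join Y T (F n) \<U>))) / real (card (F n)))))"

section \<open>Shifts and Toeplitz configurations\<close>

text \<open>The space of configurations over the group \<open>G\<close> and the alphabet \<open>A\<close> is
  \<open>carrier G \<rightarrow>\<^sub>E A\<close>, so configurations are \<open>undefined\<close> outside \<open>carrier G\<close>.\<close>

definition config_topology :: "('g, 'b) monoid_scheme \<Rightarrow> 'a set \<Rightarrow> ('g \<Rightarrow> 'a) topology" where
  "config_topology G A = product_topology (\<lambda>_. discrete_topology A) (carrier G)"

definition shift :: "('g, 'b) monoid_scheme \<Rightarrow> 'g \<Rightarrow> ('g \<Rightarrow> 'a) \<Rightarrow> ('g \<Rightarrow> 'a)" where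
  "shift G h x = (\<lambda>g\<in>carrier G. x (g \<otimes>\<^bsub>G\<^esub> h))"

definition orbit_closure :: "('g, 'b) monoid_scheme \<Rightarrow> 'a set \<Rightarrow> ('g \<Rightarrow> 'a) \<Rightarrow> ('g \<Rightarrow> 'a) set" where
  "orbit_closure G A x = config_topology G A closure_of ((\<lambda>h. shift G h x) ` carrier G)"

definition orbit_closure_topology ::
    "('g, 'b) monoid_scheme \<Rightarrow> 'a set \<Rightarrow> ('g \<Rightarrow> 'a) \<Rightarrow> ('g \<Rightarrow> 'a) topology" where
  "orbit_closure_topology G A x = subtopology (config_topology G A) (orbit_closure G A x)"

definition toeplitz :: "('g, 'b) monoid_scheme \<Rightarrow> 'a set \<Rightarrow> ('g \<Rightarrow> 'a) \<Rightarrow> bool" where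
  "toeplitz G A x \<longleftrightarrow> x \<in> carrier G \<rightarrow>\<^sub>E A \<and>
     (\<forall>g\<in>carrier G. \<exists>H. finite_index_subgroup H G \<and> (\<forall>\<gamma>\<in>H. x (\<gamma> \<otimes>\<^bsub>G\<^esub> g) = x g))"

definition Per :: "('g, 'b) monoid_scheme \<Rightarrow> 'g set \<Rightarrow> ('g \<Rightarrow> 'a) \<Rightarrow> 'g set" where
  "Per G H x = {g \<in> carrier G. \<forall>\<gamma>\<in>H. x g = x (\<gamma> \<otimes>\<^bsub>G\<^esub> g)}"

definition Per_val :: "('g, 'b) monoid_scheme \<Rightarrow> 'g set \<Rightarrow> ('g \<Rightarrow> 'a) \<Rightarrow> 'a \<Rightarrow> 'g set" where
  "Per_val G H x a = {g \<in> carrier G. \<forall>\<gamma>\<in>H. x (\<gamma> \<otimes>\<^bsub>G\<^esub> g) = a}"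

definition skeleton ::
    "('g, 'b) monoid_scheme \<Rightarrow> 'a set \<Rightarrow> ('g \<Rightarrow> 'a) \<Rightarrow> (nat \<Rightarrow> 'g set) \<Rightarrow> bool" where
  "skeleton G A x H \<longleftrightarrow>
     decseq H \<and> (\<forall>n. finite_index_subgroup (H n) G) \<and>
     (\<Union>n. Per G (H n) x) = carrier G \<and>
     (\<forall>n. Per G (H n) x \<noteq> {} \<and>
       (\<forall>g\<in>carrier G.
          (\<forall>a\<in>A. Per_val G (H n) x a = Per_val G (H n) (shift G g x) a) \<longrightarrow> g \<in> H n))"

definition regular_toeplitz :: "('g, 'b) monoid_scheme \<Rightarrow> 'a set \<Rightarrow> ('g \<Rightarrow> 'a) \<Rightarrow> bool" where
  "regular_toeplitz G A x \<longleftrightarrow> toeplitz G A x \<and>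
     (\<exists>H. skeleton G A x H \<and> (SUP n. upper_banach_density G (Per G (H n) x)) = 1)"

end

theory Submission
  imports Defs
begin

text \<open>
  Let \<open>H\<close> be a term of a regular skeleton whose periodic part \<open>P = Per G H x\<close> has upper Banach
  density above \<open>1 - \<epsilon>\<close>. The set \<open>P\<close> and the values of \<open>x\<close> on it only depend on the coset of \<open>H\<close>,
  so up to an error \<open>\<epsilon>\<close> the configuration \<open>x\<close> is pulled back from a finite quotient of \<open>G\<close>.
  Everything follows by counting in that quotient.

  The subgroup \<open>H\<close> need not be normal. Instead of passing to its normal core, the proof uses the
  permutation of the right cosets of \<open>H\<close> that an element of \<open>G\<close> induces: it defines a two-sided
  congruence on \<open>G\<close> with finitely many classes, which refines the partition into right cosets. If
  \<open>D\<close> contains one element of each class, then so does every two-sided translate \<open>h D k\<close>, whence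
  each union of classes is hit equally often by all these translates (\<open>equidistribution\<close>). For
  \<open>B = P\<close> this bounds the upper Banach density of \<open>P\<close> by its relative frequency in \<open>D\<close>; hence at
  most \<open>\<epsilon> |D|\<close> elements of any \<open>h D k\<close> lie outside \<open>P\<close>. This structure is called
  \<open>approximate_period\<close>. By compactness each \<open>y\<close> in the orbit closure has some \<open>d \<in> D\<close> such that
  \<open>y\<close> and the translate of \<open>x\<close> by \<open>d\<close> agree at all \<open>h\<close> with \<open>h d \<in> P\<close>
  (\<open>orbit_closure_periodic_part\<close>).

  Unique ergodicity: if \<open>C\<close> depends on a finite set \<open>K\<close> of coordinates, then the proportion of
  \<open>f \<in> h D\<close> that translate \<open>y\<close> into \<open>C\<close> is within \<open>|K| \<epsilon>\<close> of a number that is independent of \<open>y\<close>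
  and \<open>h\<close> (\<open>uniform_average\<close>). As \<open>\<epsilon>\<close> tends to 0 these proportions converge uniformly to a number
  \<open>mean C\<close>. Integrating them against an invariant measure shows that it takes the value \<open>mean C\<close> at
  \<open>C\<close>, which gives uniqueness. For existence, \<open>mean\<close> is an invariant, finitely additive function on
  the algebra of such sets; these are compact and open, so it is automatically continuous at
  the empty set, and extends to a measure by the theorem of Caratheodory.

  Entropy: a pattern of a point \<open>y\<close> on a finite set \<open>S\<close> is determined by \<open>d \<in> D\<close> and by the letters
  at the positions \<open>s \<in> S\<close> with \<open>s d \<notin> P\<close>. An open cover is refined by the patterns on some finite
  set \<open>K\<close>, so its join over \<open>F\<close> is refined by the patterns on \<open>K F\<close>. If \<open>F\<close> is far along a Folner
  sequence, only about \<open>\<epsilon> |K| |F|\<close> positions of \<open>K F\<close> are free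
  (\<open>folner_frequency_saturated\<close>). Thus the logarithm of the number of patterns is at most about
  \<open>ln |D| + \<epsilon> |K| |F| ln |A|\<close>. Since \<open>G\<close> is infinite, \<open>|F|\<close> tends to infinity, and after division
  by \<open>|F|\<close> only a multiple of \<open>\<epsilon>\<close> remains.
\<close>

section \<open>Finite congruences and equidistribution\<close>

text \<open>Quotients of a group are represented by a labelling \<open>\<phi>\<close> of its elements; only the partition
  into fibres matters. Such a partition is the coset partition of a normal subgroup of finite index.\<close>

definition finite_congruence :: "('g, 'b) monoid_scheme \<Rightarrow> ('g \<Rightarrow> 'c) \<Rightarrow> bool" where
  "finite_congruence G \<phi> \<longleftrightarrow> finite (\<phi> ` carrier G) \<and>
     (\<forall>g\<in>carrier G. \<forall>g'\<in>carrier G. \<forall>h\<in>carrier G. \<forall>k\<in>carrier G.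
        \<phi> g = \<phi> g' \<longrightarrow> \<phi> (h \<otimes>\<^bsub>G\<^esub> g \<otimes>\<^bsub>G\<^esub> k) = \<phi> (h \<otimes>\<^bsub>G\<^esub> g' \<otimes>\<^bsub>G\<^esub> k))"

definition transversal :: "('g, 'b) monoid_scheme \<Rightarrow> ('g \<Rightarrow> 'c) \<Rightarrow> 'g set \<Rightarrow> bool" where
  "transversal G \<phi> D \<longleftrightarrow> D \<subseteq> carrier G \<and> bij_betw \<phi> D (\<phi> ` carrier G)"

definition saturated :: "('g, 'b) monoid_scheme \<Rightarrow> ('g \<Rightarrow> 'c) \<Rightarrow> 'g set \<Rightarrow> bool" where
  "saturated G \<phi> B \<longleftrightarrow> (\<forall>g\<in>carrier G. \<forall>g'\<in>carrier G. \<phi> g = \<phi> g' \<longrightarrow> g \<in> B \<longrightarrow> g' \<in> B)"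

lemma saturatedD:
  "saturated G \<phi> B \<Longrightarrow> g \<in> B \<Longrightarrow> \<phi> g = \<phi> g' \<Longrightarrow> g \<in> carrier G \<Longrightarrow> g' \<in> carrier G \<Longrightarrow> g' \<in> B"
  unfolding saturated_def by blast

lemma finite_congruenceD:
  "finite_congruence G \<phi> \<Longrightarrow> \<phi> g = \<phi> g' \<Longrightarrow> g \<in> carrier G \<Longrightarrow> g' \<in> carrier G \<Longrightarrow>
    h \<in> carrier G \<Longrightarrow> k \<in> carrier G \<Longrightarrow> \<phi> (h \<otimes>\<^bsub>G\<^esub> g \<otimes>\<^bsub>G\<^esub> k) = \<phi> (h \<otimes>\<^bsub>G\<^esub> g' \<otimes>\<^bsub>G\<^esub> k)"
  unfolding finite_congruence_def by blast

context group
begin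

lemma congruence_left:
  assumes "finite_congruence G \<phi>" "\<phi> g = \<phi> g'" "g \<in> carrier G" "g' \<in> carrier G" "h \<in> carrier G"
  shows "\<phi> (h \<otimes> g) = \<phi> (h \<otimes> g')"
  using finite_congruenceD[OF assms(1-5), of \<one>] assms by simp

lemma congruence_cancel:
  assumes \<phi>: "finite_congruence G \<phi>" and eq: "\<phi> (h \<otimes> g \<otimes> k) = \<phi> (h \<otimes> g' \<otimes> k)"
    and c: "g \<in> carrier G" "g' \<in> carrier G" "h \<in> carrier G" "k \<in> carrier G"
  shows "\<phi> g = \<phi> g'"
proof -
  have red: "inv h \<otimes> (h \<otimes> u \<otimes> k) \<otimes> inv k = u" if "u \<in> carrier G" for u
    using that c by (simp add: m_assoc[symmetric]) (simp add: m_assoc)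
  show ?thesis
    using finite_congruenceD[OF \<phi> eq, of "inv h" "inv k"] c by (simp add: red)
qed

lemma transversal_exists:
  obtains D where "transversal G \<phi> D"
proof -
  obtain D where "D \<subseteq> carrier G" "inj_on \<phi> D" "\<phi> ` carrier G = \<phi> ` D"
    using subset_image_inj[of "\<phi> ` carrier G" \<phi> "carrier G"] by auto
  then show ?thesis
    using that unfolding transversal_def bij_betw_def by metis
qed

lemma transversal_finite:
  assumes "finite_congruence G \<phi>" "transversal G \<phi> D"
  shows "finite D" "D \<noteq> {}" "card D > 0"
proof -
  show f: "finite D"
    using assms bij_betw_finite unfolding finite_congruence_def transversal_def by blast
  show "D \<noteq> {}"
    using assms one_closed unfolding transversal_def bij_betw_def by blast
  then show "card D > 0" using f by auto
qed

lemma transversal_rep: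
  assumes "transversal G \<phi> D" "g \<in> carrier G"
  obtains d where "d \<in> D" "d \<in> carrier G" "\<phi> d = \<phi> g"
proof -
  have "\<phi> g \<in> \<phi> ` D"
    using assms unfolding transversal_def bij_betw_def by auto
  then show ?thesis using that assms unfolding transversal_def by force
qed

text \<open>Because the congruence is two-sided and translations are invertible, \<open>d \<mapsto> \<phi> (h \<otimes> d \<otimes> k)\<close> is again a
  bijection between \<open>D\<close> and the classes. The count is therefore the number of classes in \<open>B\<close>,
  whatever \<open>h\<close> and \<open>k\<close> are.\<close>

lemma equidistribution:
  assumes \<phi>: "finite_congruence G \<phi>" and D: "transversal G \<phi> D" and B: "saturated G \<phi> B"
    and h: "h \<in> carrier G" and k: "k \<in> carrier G"
  shows "card {d \<in> D. h \<otimes> d \<otimes> k \<in> B} = card (\<phi> ` (B \<inter> carrier G))"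
proof (rule bij_betw_same_card)
  have Dc: "d \<in> carrier G" if "d \<in> D" for d
    using D that unfolding transversal_def by blast
  have inj: "inj_on (\<lambda>d. \<phi> (h \<otimes> d \<otimes> k)) {d \<in> D. h \<otimes> d \<otimes> k \<in> B}"
  proof (rule inj_onI)
    fix d d' assume d: "d \<in> {d \<in> D. h \<otimes> d \<otimes> k \<in> B}" "d' \<in> {d \<in> D. h \<otimes> d \<otimes> k \<in> B}"
      and eq: "\<phi> (h \<otimes> d \<otimes> k) = \<phi> (h \<otimes> d' \<otimes> k)"
    then have "\<phi> d = \<phi> d'"
      using congruence_cancel[OF \<phi> eq] h k Dc by simp
    then show "d = d'"
      using d D unfolding transversal_def bij_betw_def inj_on_def by blast
  qed
  have "(\<lambda>d. \<phi> (h \<otimes> d \<otimes> k)) ` {d \<in> D. h \<otimes> d \<otimes> k \<in> B} = \<phi> ` (B \<inter> carrier G)"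
  proof
    show "(\<lambda>d. \<phi> (h \<otimes> d \<otimes> k)) ` {d \<in> D. h \<otimes> d \<otimes> k \<in> B} \<subseteq> \<phi> ` (B \<inter> carrier G)"
      using Dc h k by auto
  next
    show "\<phi> ` (B \<inter> carrier G) \<subseteq> (\<lambda>d. \<phi> (h \<otimes> d \<otimes> k)) ` {d \<in> D. h \<otimes> d \<otimes> k \<in> B}"
    proof
      fix c assume "c \<in> \<phi> ` (B \<inter> carrier G)"
      then obtain b where b: "b \<in> B" "b \<in> carrier G" "c = \<phi> b" by blast
      obtain d where d: "d \<in> D" "d \<in> carrier G" "\<phi> d = \<phi> (inv h \<otimes> b \<otimes> inv k)"
        using transversal_rep[OF D, of "inv h \<otimes> b \<otimes> inv k"] b h k by auto
      have "h \<otimes> (inv h \<otimes> b \<otimes> inv k) \<otimes> k = b"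
        using h k b by (simp add: m_assoc[symmetric]) (simp add: m_assoc)
      then have eq: "\<phi> (h \<otimes> d \<otimes> k) = \<phi> b"
        using finite_congruenceD[OF \<phi> d(3), of h k] d b h k by simp
      then have "h \<otimes> d \<otimes> k \<in> B"
        using saturatedD[OF B b(1) eq[symmetric]] d b h k by simp
      then show "c \<in> (\<lambda>d. \<phi> (h \<otimes> d \<otimes> k)) ` {d \<in> D. h \<otimes> d \<otimes> k \<in> B}"
        using d b eq by (intro image_eqI[of _ _ d]) auto
    qed
  qed
  then show "bij_betw (\<lambda>d. \<phi> (h \<otimes> d \<otimes> k)) {d \<in> D. h \<otimes> d \<otimes> k \<in> B} (\<phi> ` (B \<inter> carrier G))"
    using inj unfolding bij_betw_def by blast
qed

lemma saturated_diff: "saturated G \<phi> B \<Longrightarrow> saturated G \<phi> (carrier G - B)"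
  unfolding saturated_def by (metis Diff_iff)

text \<open>The kernel of this permutation action is the normal core of \<open>H\<close>; the labelling thus plays the
  role of the quotient map by the core.\<close>

definition coset_action :: "'a set \<Rightarrow> 'a \<Rightarrow> 'a set \<Rightarrow> 'a set" where
  "coset_action H g = (\<lambda>C\<in>rcosets H. C #> g)"

lemma rcosets_translate:
  assumes "subgroup H G" "C \<in> rcosets H" "g \<in> carrier G"
  shows "C #> g \<in> rcosets H"
proof -
  obtain c where c: "c \<in> carrier G" "C = H #> c" using assms unfolding RCOSETS_def by auto
  then have "C #> g = H #> (c \<otimes> g)"
    using assms coset_mult_assoc subgroup.subset by blast
  then show ?thesis using c assms unfolding RCOSETS_def by auto
qed

lemma coset_action_congruence:
  assumes "finite_index_subgroup H G"
  shows "finite_congruence G (coset_action H)"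
proof -
  have H: "subgroup H G" and fin: "finite (rcosets H)"
    using assms unfolding finite_index_subgroup_def by auto
  have "coset_action H ` carrier G \<subseteq> (rcosets H) \<rightarrow>\<^sub>E (rcosets H)"
    using rcosets_translate[OF H] unfolding coset_action_def by auto
  then have 1: "finite (coset_action H ` carrier G)"
    using fin finite_PiE by (metis finite_subset)
  have "coset_action H (h \<otimes> g \<otimes> k) = coset_action H (h \<otimes> g' \<otimes> k)"
    if c: "g \<in> carrier G" "g' \<in> carrier G" "h \<in> carrier G" "k \<in> carrier G"
      and eq: "coset_action H g = coset_action H g'" for g g' h k
  proof -
    have eqC: "C #> g = C #> g'" if "C \<in> rcosets H" for C
      using fun_cong[OF eq, of C] that unfolding coset_action_def by simp
    have "C #> (h \<otimes> g \<otimes> k) = C #> (h \<otimes> g' \<otimes> k)" if C: "C \<in> rcosets H" for C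
    proof -
      have sub: "C \<subseteq> carrier G" using C H rcosets_part_G by blast
      have exp: "C #> (h \<otimes> u \<otimes> k) = ((C #> h) #> u) #> k" if "u \<in> carrier G" for u
        using that c sub by (simp add: coset_mult_assoc r_coset_subset_G)
      show ?thesis using exp eqC[OF rcosets_translate[OF H C c(3)]] c by simp
    qed
    then show ?thesis unfolding coset_action_def by (intro restrict_ext)
  qed
  then show ?thesis using 1 unfolding finite_congruence_def by blast
qed

text \<open>Elements that act alike move the coset \<open>H\<close> itself to the same place, that is, they lie in the
  same right coset of \<open>H\<close>.\<close>

lemma coset_action_eqD:
  assumes H: "subgroup H G" and g: "g \<in> carrier G" "g' \<in> carrier G"
    and eq: "coset_action H g = coset_action H g'"
  obtains \<gamma> where "\<gamma> \<in> H" "g' = \<gamma> \<otimes> g"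
proof -
  have "H \<in> rcosets H" using subgroup.subgroup_in_rcosets[OF H] is_group by blast
  then have "H #> g = H #> g'"
    using fun_cong[OF eq, of H] unfolding coset_action_def by simp
  then have "g' \<in> H #> g" using H g rcos_self by blast
  then show ?thesis using that unfolding r_coset_def by auto
qed

lemma Per_coset_action:
  assumes H: "subgroup H G" and p: "p \<in> Per G H x" and g: "g \<in> carrier G"
    and eq: "coset_action H p = coset_action H g"
  shows "g \<in> Per G H x" "x g = x p"
proof -
  have pc: "p \<in> carrier G" and px: "\<And>\<gamma>. \<gamma> \<in> H \<Longrightarrow> x p = x (\<gamma> \<otimes> p)"
    using p unfolding Per_def by auto
  obtain \<gamma> where \<gamma>: "\<gamma> \<in> H" "g = \<gamma> \<otimes> p" using coset_action_eqD[OF H pc g eq] by blast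
  show 1: "x g = x p" using px \<gamma> by simp
  have "x g = x (\<gamma>' \<otimes> g)" if "\<gamma>' \<in> H" for \<gamma>'
  proof -
    have "\<gamma>' \<otimes> g = (\<gamma>' \<otimes> \<gamma>) \<otimes> p"
      using \<gamma> that pc H subgroup.mem_carrier by (metis m_assoc)
    then show ?thesis using px[of "\<gamma>' \<otimes> \<gamma>"] 1 that \<gamma> H subgroup.m_closed by metis
  qed
  then show "g \<in> Per G H x" using g unfolding Per_def by auto
qed

section \<open>Upper Banach density\<close>

text \<open>This bounds the suprema in the definition of the density. Without such bounds the
  conditionally complete \<open>SUP\<close> and \<open>INF\<close> of reals carry no information.\<close>

lemma translate_ratio_le_1:
  assumes "finite F"
  shows "real (card (B \<inter> (F #> g))) / real (card F) \<le> 1"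
proof -
  have im: "F #> g = (\<lambda>f. f \<otimes> g) ` F" unfolding r_coset_def by auto
  have "card (B \<inter> (F #> g)) \<le> card F"
    using card_mono[of "F #> g" "B \<inter> (F #> g)"] card_image_le[OF assms, of "\<lambda>f. f \<otimes> g"]
      assms unfolding im by auto
  then show ?thesis by (simp add: divide_le_eq_1) linarith
qed

lemma upper_banach_density_le:
  assumes F: "finite F" "F \<noteq> {}" "F \<subseteq> carrier G"
    and le: "\<And>g. g \<in> carrier G \<Longrightarrow> real (card (B \<inter> (F #> g))) / real (card F) \<le> c"
  shows "upper_banach_density G B \<le> c"
proof -
  have ub: "bdd_above ((\<lambda>g. real (card (B \<inter> (F #> g))) / real (card F)) ` carrier G)"
    if "finite F" for F
    using translate_ratio_le_1[OF that] by (intro bdd_aboveI2[of _ _ 1]) auto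
  have ge0: "0 \<le> (SUP g\<in>carrier G. real (card (B \<inter> (F #> g))) / real (card F))"
    if "finite F" for F
    by (rule cSUP_upper2[OF ub[OF that] one_closed]) auto
  have "upper_banach_density G B \<le> (SUP g\<in>carrier G. real (card (B \<inter> (F #> g))) / real (card F))"
    unfolding upper_banach_density_def
    by (rule cINF_lower) (use F ge0 in \<open>auto intro!: bdd_belowI2[of _ 0]\<close>)
  also have "\<dots> \<le> c"
    using le by (intro cSUP_least) auto
  finally show ?thesis .
qed

lemma upper_banach_density_le_1: "upper_banach_density G B \<le> 1"
  using upper_banach_density_le[of "{\<one>}"] translate_ratio_le_1[of "{\<one>}"] by simp

text \<open>A transversal is an admissible finite set in the infimum that defines the density, and by
  equidistribution all its right translates meet \<open>B\<close> equally often, so the inner supremum is the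
  plain frequency of \<open>B\<close> in \<open>D\<close>.\<close>

lemma upper_banach_density_saturated_le:
  assumes \<phi>: "finite_congruence G \<phi>" and D: "transversal G \<phi> D" and B: "saturated G \<phi> B"
  shows "upper_banach_density G B \<le> real (card {d \<in> D. d \<in> B}) / real (card D)"
proof (rule upper_banach_density_le)
  show D1: "finite D" "D \<noteq> {}" using transversal_finite[OF \<phi> D] by auto
  show D2: "D \<subseteq> carrier G" using D unfolding transversal_def by auto
  fix g assume g: "g \<in> carrier G"
  have "B \<inter> (D #> g) \<subseteq> (\<lambda>d. d \<otimes> g) ` {d \<in> D. \<one> \<otimes> d \<otimes> g \<in> B}"
    using D2 g unfolding r_coset_def by auto
  moreover have "finite ((\<lambda>d. d \<otimes> g) ` {d \<in> D. \<one> \<otimes> d \<otimes> g \<in> B})" using D1 by simp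
  ultimately have "card (B \<inter> (D #> g)) \<le> card ((\<lambda>d. d \<otimes> g) ` {d \<in> D. \<one> \<otimes> d \<otimes> g \<in> B})"
    by (rule card_mono[rotated])
  also have "\<dots> \<le> card {d \<in> D. \<one> \<otimes> d \<otimes> g \<in> B}"
    using D1 by (intro card_image_le) simp
  also have "\<dots> = card {d \<in> D. \<one> \<otimes> d \<otimes> \<one> \<in> B}"
    using equidistribution[OF \<phi> D B] g by simp
  also have "{d \<in> D. \<one> \<otimes> d \<otimes> \<one> \<in> B} = {d \<in> D. d \<in> B}"
    using D2 by auto
  finally show "real (card (B \<inter> (D #> g))) / real (card D) \<le> real (card {d \<in> D. d \<in> B}) / real (card D)"
    by (simp add: divide_right_mono)
qed

section \<open>Frequencies along Folner sequences\<close>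

text \<open>A set \<open>F\<close> that is almost invariant under left translation by the finitely many elements of \<open>D\<close>
  can be averaged over \<open>D\<close> at small cost. After exchanging the two sums, for each single \<open>f\<close> the
  average over \<open>D\<close> is controlled by equidistribution. One \<open>\<epsilon>\<close> of the bound pays for the invariance
  defect of \<open>F\<close>, the other is the frequency of \<open>B\<close>.\<close>

lemma folner_frequency_saturated:
  assumes \<phi>: "finite_congruence G \<phi>" and D: "transversal G \<phi> D" and B: "saturated G \<phi> B"
    and F: "folner_sequence G F" and k: "k \<in> carrier G" "g \<in> carrier G"
    and le: "real (card {d \<in> D. d \<in> B}) \<le> \<epsilon> * real (card D)" and \<epsilon>: "\<epsilon> > 0"
  shows "\<forall>\<^sub>F n in sequentially. real (card {f \<in> F n. k \<otimes> f \<otimes> g \<in> B}) \<le> 2 * \<epsilon> * real (card (F n))"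
proof -
  have D1: "finite D" "card D > 0" using transversal_finite[OF \<phi> D] by auto
  have D2: "D \<subseteq> carrier G" using D unfolding transversal_def by auto
  have F1: "finite (F n)" "F n \<subseteq> carrier G" "card (F n) > 0" for n
    using F unfolding folner_sequence_def by (auto simp: card_gt_0_iff)
  define B' where "B' f = (k \<otimes> f \<otimes> g \<in> B)" for f
  have "\<forall>\<^sub>F n in sequentially. \<forall>d\<in>D.
      real (card (sym_diff (d <#\<^bsub>G\<^esub> F n) (F n))) / real (card (F n)) < \<epsilon>"
  proof (rule eventually_ball_finite[OF D1(1)], rule ballI)
    fix d assume "d \<in> D"
    then have "(\<lambda>n. real (card (sym_diff (d <#\<^bsub>G\<^esub> F n) (F n))) / real (card (F n))) \<longlonglongrightarrow> 0"
      using F D2 unfolding folner_sequence_def by blast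
    then show "\<forall>\<^sub>F n in sequentially. real (card (sym_diff (d <#\<^bsub>G\<^esub> F n) (F n))) / real (card (F n)) < \<epsilon>"
      using \<epsilon> order_tendstoD(2) by blast
  qed
  then show ?thesis
  proof (rule eventually_mono)
    fix n assume small: "\<forall>d\<in>D. real (card (sym_diff (d <#\<^bsub>G\<^esub> F n) (F n))) / real (card (F n)) < \<epsilon>"
    let ?c = "real (card {f \<in> F n. B' f})"
    \<comment> \<open>A counted \<open>f\<close> is \<open>d \<otimes> f'\<close> with \<open>f'\<close> in \<open>F n\<close>, unless it lies in the symmetric difference.\<close>
    have each: "?c \<le> real (card {f \<in> F n. B' (d \<otimes> f)}) + \<epsilon> * real (card (F n))" if d: "d \<in> D" for d
    proof -
      have fin: "finite (d <#\<^bsub>G\<^esub> F n)" using F1 unfolding l_coset_def by auto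
      have "{f \<in> F n. B' f} \<subseteq> (\<lambda>f. d \<otimes> f) ` {f \<in> F n. B' (d \<otimes> f)} \<union> sym_diff (d <#\<^bsub>G\<^esub> F n) (F n)"
        unfolding l_coset_def by auto
      then have "card {f \<in> F n. B' f} \<le> card ((\<lambda>f. d \<otimes> f) ` {f \<in> F n. B' (d \<otimes> f)} \<union> sym_diff (d <#\<^bsub>G\<^esub> F n) (F n))"
        using F1 fin by (intro card_mono) auto
      also have "\<dots> \<le> card ((\<lambda>f. d \<otimes> f) ` {f \<in> F n. B' (d \<otimes> f)}) + card (sym_diff (d <#\<^bsub>G\<^esub> F n) (F n))"
        by (rule card_Un_le)
      also have "card ((\<lambda>f. d \<otimes> f) ` {f \<in> F n. B' (d \<otimes> f)}) \<le> card {f \<in> F n. B' (d \<otimes> f)}"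
        using F1 by (intro card_image_le) auto
      finally have "?c \<le> real (card {f \<in> F n. B' (d \<otimes> f)}) + real (card (sym_diff (d <#\<^bsub>G\<^esub> F n) (F n)))"
        by linarith
      moreover have "real (card (sym_diff (d <#\<^bsub>G\<^esub> F n) (F n))) \<le> \<epsilon> * real (card (F n))"
        using small d F1(3)[of n] by (auto simp: divide_less_eq less_imp_le)
      ultimately show ?thesis by linarith
    qed
    have inner: "real (card {d \<in> D. B' (d \<otimes> f)}) \<le> \<epsilon> * real (card D)" if f: "f \<in> F n" for f
    proof -
      have fc: "f \<in> carrier G" using f F1 by blast
      have "{d \<in> D. B' (d \<otimes> f)} = {d \<in> D. k \<otimes> d \<otimes> (f \<otimes> g) \<in> B}"
        using D2 fc k unfolding B'_def by (auto simp: m_assoc subset_iff)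
      also have "card \<dots> = card {d \<in> D. \<one> \<otimes> d \<otimes> \<one> \<in> B}"
        using equidistribution[OF \<phi> D B] fc k by simp
      also have "{d \<in> D. \<one> \<otimes> d \<otimes> \<one> \<in> B} = {d \<in> D. d \<in> B}"
        using D2 by auto
      finally show ?thesis using le by simp
    qed
    have "real (card D) * ?c = (\<Sum>d\<in>D. ?c)" by simp
    also have "\<dots> \<le> (\<Sum>d\<in>D. real (card {f \<in> F n. B' (d \<otimes> f)}) + \<epsilon> * real (card (F n)))"
      by (intro sum_mono each)
    also have "\<dots> = (\<Sum>d\<in>D. real (card {f \<in> F n. B' (d \<otimes> f)})) + real (card D) * (\<epsilon> * real (card (F n)))"
      by (simp add: sum.distrib)
    also have "(\<Sum>d\<in>D. real (card {f \<in> F n. B' (d \<otimes> f)})) = (\<Sum>f\<in>F n. real (card {d \<in> D. B' (d \<otimes> f)}))"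
    proof -
      have "(\<Sum>d\<in>D. card {f \<in> F n. B' (d \<otimes> f)}) = (\<Sum>f\<in>F n. card {d \<in> D. B' (d \<otimes> f)})"
        by (rule sum_multicount_gen) (use D1 F1 in auto)
      from arg_cong[OF this, of real] show ?thesis by simp
    qed
    also have "\<dots> \<le> (\<Sum>f\<in>F n. \<epsilon> * real (card D))"
      by (intro sum_mono inner)
    also have "\<dots> = real (card D) * (\<epsilon> * real (card (F n)))" by simp
    finally have "real (card D) * ?c \<le> real (card D) * (2 * \<epsilon> * real (card (F n)))"
      by (simp add: algebra_simps)
    then show "real (card {f \<in> F n. k \<otimes> f \<otimes> g \<in> B}) \<le> 2 * \<epsilon> * real (card (F n))"
      using D1 unfolding B'_def by simp
  qed
qed

text \<open>If \<open>F n\<close> has at most \<open>M\<close> elements and differs from a translate of itself by a proportion below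
  \<open>1 / (M + 1)\<close>, then it equals this translate. A set invariant under \<open>M + 1\<close> translations contains \<open>M + 1\<close> translates of each
  of its points, which is impossible for \<open>F n\<close>.\<close>

lemma folner_card_at_top:
  assumes inf: "infinite (carrier G)" and F: "folner_sequence G F"
  shows "filterlim (\<lambda>n. card (F n)) at_top sequentially"
  unfolding filterlim_at_top
proof
  fix M :: nat
  have F1: "finite (F n)" "F n \<subseteq> carrier G" "F n \<noteq> {}" "card (F n) > 0" for n
    using F unfolding folner_sequence_def by (auto simp: card_gt_0_iff)
  obtain S where S: "S \<subseteq> carrier G" "finite S" "card S = Suc M"
    using inf infinite_arbitrarily_large by metis
  have "\<forall>\<^sub>F n in sequentially. \<forall>d\<in>S.
      real (card (sym_diff (d <#\<^bsub>G\<^esub> F n) (F n))) / real (card (F n)) < 1 / Suc M"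
  proof (rule eventually_ball_finite[OF S(2)], rule ballI)
    fix d assume "d \<in> S"
    then have "(\<lambda>n. real (card (sym_diff (d <#\<^bsub>G\<^esub> F n) (F n))) / real (card (F n))) \<longlonglongrightarrow> 0"
      using F S unfolding folner_sequence_def by blast
    then show "\<forall>\<^sub>F n in sequentially. real (card (sym_diff (d <#\<^bsub>G\<^esub> F n) (F n))) / real (card (F n)) < 1 / Suc M"
      by (rule order_tendstoD(2)) simp
  qed
  then show "\<forall>\<^sub>F n in sequentially. M \<le> card (F n)"
  proof (rule eventually_mono)
    fix n assume small: "\<forall>d\<in>S. real (card (sym_diff (d <#\<^bsub>G\<^esub> F n) (F n))) / real (card (F n)) < 1 / Suc M"
    show "M \<le> card (F n)"
    proof (rule ccontr)
      assume less: "\<not> M \<le> card (F n)"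
      obtain f where f: "f \<in> F n" using F1 by blast
      have "d \<otimes> f \<in> F n" if d: "d \<in> S" for d
      proof -
        have fin: "finite (sym_diff (d <#\<^bsub>G\<^esub> F n) (F n))" using F1 unfolding l_coset_def by auto
        have "real (card (sym_diff (d <#\<^bsub>G\<^esub> F n) (F n))) < real (card (F n)) / Suc M"
          using small d F1(4)[of n] by (auto simp: divide_less_eq)
        also have "\<dots> \<le> 1" using less by simp
        finally have "sym_diff (d <#\<^bsub>G\<^esub> F n) (F n) = {}" using fin by simp
        then show ?thesis using f unfolding l_coset_def by auto
      qed
      moreover have "inj_on (\<lambda>d. d \<otimes> f) S"
        using S f F1 by (auto simp: inj_on_def subset_iff)
      ultimately have "card S \<le> card (F n)"
        using F1 by (intro card_inj_on_le[of "\<lambda>d. d \<otimes> f"]) auto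
      then show False using S less by simp
    qed
  qed
qed

end

section \<open>The orbit closure\<close>

locale shift_orbit = group G for G :: "('g, 'b) monoid_scheme" (structure) +
  fixes A :: "'a set" and x :: "'g \<Rightarrow> 'a"
  assumes finite_alphabet: "finite A" and base_config: "x \<in> carrier G \<rightarrow>\<^sub>E A"
begin

abbreviation Y :: "('g \<Rightarrow> 'a) set" where
  "Y \<equiv> orbit_closure G A x"

abbreviation T :: "'g \<Rightarrow> ('g \<Rightarrow> 'a) \<Rightarrow> ('g \<Rightarrow> 'a)" where
  "T \<equiv> shift G"

abbreviation Ytop :: "('g \<Rightarrow> 'a) topology" where
  "Ytop \<equiv> orbit_closure_topology G A x"

lemma topspace_config: "topspace (config_topology G A) = carrier G \<rightarrow>\<^sub>E A"
  unfolding config_topology_def by simp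

lemma shift_apply: "g \<in> carrier G \<Longrightarrow> T h y g = y (g \<otimes> h)"
  unfolding shift_def by simp

lemma shift_config: "y \<in> carrier G \<rightarrow>\<^sub>E A \<Longrightarrow> h \<in> carrier G \<Longrightarrow> T h y \<in> carrier G \<rightarrow>\<^sub>E A"
  unfolding shift_def by auto

lemma shift_shift: "h \<in> carrier G \<Longrightarrow> k \<in> carrier G \<Longrightarrow> T h (T k y) = T (h \<otimes> k) y"
  unfolding shift_def by (auto simp: m_assoc restrict_def fun_eq_iff)

lemma cylinder_open:
  assumes "finite K" "K \<subseteq> carrier G"
  shows "openin (config_topology G A) {y \<in> carrier G \<rightarrow>\<^sub>E A. \<forall>k\<in>K. y k = z k}"
proof -
  have "{y \<in> carrier G \<rightarrow>\<^sub>E A. \<forall>k\<in>K. y k = z k}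
      = Pi\<^sub>E (carrier G) (\<lambda>g. if g \<in> K then {z g} \<inter> A else A)"
    using assms(2) by (auto simp: PiE_def Pi_def extensional_def split: if_splits)
  moreover have "finite {g \<in> carrier G. (if g \<in> K then {z g} \<inter> A else A) \<noteq> A}"
    by (rule finite_subset[OF _ assms(1)]) auto
  ultimately show ?thesis
    unfolding config_topology_def by (simp add: openin_PiE_gen)
qed

lemma open_contains_cylinder:
  assumes "openin (config_topology G A) U" "y \<in> U"
  obtains K where "finite K" "K \<subseteq> carrier G"
    "\<And>z. z \<in> carrier G \<rightarrow>\<^sub>E A \<Longrightarrow> (\<And>k. k \<in> K \<Longrightarrow> z k = y k) \<Longrightarrow> z \<in> U"
proof -
  have "\<exists>V. finite {i \<in> carrier G. V i \<noteq> A} \<and> (\<forall>i\<in>carrier G. openin (discrete_topology A) (V i)) \<and>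
      y \<in> Pi\<^sub>E (carrier G) V \<and> Pi\<^sub>E (carrier G) V \<subseteq> U"
    using bspec[OF iffD1[OF openin_product_topology_alt assms(1)[unfolded config_topology_def]] assms(2)]
    unfolding topspace_discrete_topology .
  then obtain V where "finite {i \<in> carrier G. V i \<noteq> A} \<and> (\<forall>i\<in>carrier G. openin (discrete_topology A) (V i)) \<and>
      y \<in> Pi\<^sub>E (carrier G) V \<and> Pi\<^sub>E (carrier G) V \<subseteq> U" ..
  then have V: "finite {i \<in> carrier G. V i \<noteq> A}"
      "y \<in> Pi\<^sub>E (carrier G) V" "Pi\<^sub>E (carrier G) V \<subseteq> U"
    by simp_all
  show ?thesis
  proof (rule that[OF V(1)])
    fix z assume z: "z \<in> carrier G \<rightarrow>\<^sub>E A" "\<And>k. k \<in> {i \<in> carrier G. V i \<noteq> A} \<Longrightarrow> z k = y k"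
    have "z g \<in> V g" if "g \<in> carrier G" for g
      using z V(2) that by (cases "V g = A") (auto simp: PiE_def Pi_def)
    then show "z \<in> U" using z V(3) by (auto simp: PiE_def Pi_def)
  qed auto
qed

text \<open>The combinatorial form of the closure: all finite patterns of \<open>y\<close> occur in \<open>x\<close>. The topology
  is used below only through this description, compactness, and the cylinder neighbourhoods.\<close>

lemma mem_orbit_closure:
  "y \<in> Y \<longleftrightarrow> y \<in> carrier G \<rightarrow>\<^sub>E A \<and>
     (\<forall>K. finite K \<longrightarrow> K \<subseteq> carrier G \<longrightarrow> (\<exists>g\<in>carrier G. \<forall>k\<in>K. y k = x (k \<otimes> g)))"
  (is "_ \<longleftrightarrow> _ \<and> ?approx")
proof
  assume y: "y \<in> Y"
  then have yc: "y \<in> carrier G \<rightarrow>\<^sub>E A"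
    unfolding orbit_closure_def in_closure_of topspace_config by (rule conjunct1)
  have "\<exists>g\<in>carrier G. \<forall>k\<in>K. y k = x (k \<otimes> g)" if K: "finite K" "K \<subseteq> carrier G" for K
  proof -
    have "\<exists>z. z \<in> (\<lambda>h. T h x) ` carrier G \<and> z \<in> {z \<in> carrier G \<rightarrow>\<^sub>E A. \<forall>k\<in>K. z k = y k}"
      using y[unfolded orbit_closure_def in_closure_of, THEN conjunct2, rule_format, OF conjI,
          OF _ cylinder_open[OF K]] yc by simp
    then obtain g where "g \<in> carrier G" "\<forall>k\<in>K. T g x k = y k" by blast
    then have "\<forall>k\<in>K. y k = x (k \<otimes> g)" using K(2) by (auto simp: shift_apply subset_iff)
    then show ?thesis using \<open>g \<in> carrier G\<close> by blast
  qed
  then show "y \<in> carrier G \<rightarrow>\<^sub>E A \<and> ?approx" using yc by blast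
next
  assume y: "y \<in> carrier G \<rightarrow>\<^sub>E A \<and> ?approx"
  have "\<exists>z. z \<in> (\<lambda>h. T h x) ` carrier G \<and> z \<in> U"
    if U: "y \<in> U" "openin (config_topology G A) U" for U
  proof -
    obtain K where K: "finite K" "K \<subseteq> carrier G"
      "\<And>z. z \<in> carrier G \<rightarrow>\<^sub>E A \<Longrightarrow> (\<And>k. k \<in> K \<Longrightarrow> z k = y k) \<Longrightarrow> z \<in> U"
      using open_contains_cylinder[OF U(2,1)] by blast
    obtain g where g: "g \<in> carrier G" "\<forall>k\<in>K. y k = x (k \<otimes> g)" using y K by blast
    have "T g x \<in> U"
      using K(2) g by (intro K(3) shift_config base_config) (auto simp: shift_apply)
    then show ?thesis using g by blast
  qed
  then show "y \<in> Y"
    using y unfolding orbit_closure_def in_closure_of topspace_config by simp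
qed

lemma orbit_closure_config: "y \<in> Y \<Longrightarrow> y \<in> carrier G \<rightarrow>\<^sub>E A"
  using mem_orbit_closure by blast

lemma shift_orbit_closure:
  assumes "y \<in> Y" "h \<in> carrier G"
  shows "T h y \<in> Y"
proof -
  have "\<exists>g\<in>carrier G. \<forall>k\<in>K. T h y k = x (k \<otimes> g)" if K: "finite K" "K \<subseteq> carrier G" for K
  proof -
    have "finite ((\<lambda>k. k \<otimes> h) ` K)" "(\<lambda>k. k \<otimes> h) ` K \<subseteq> carrier G"
      using K assms by auto
    then obtain g where g: "g \<in> carrier G" "\<forall>k\<in>(\<lambda>k. k \<otimes> h) ` K. y k = x (k \<otimes> g)"
      using assms mem_orbit_closure by blast
    have "T h y k = x (k \<otimes> (h \<otimes> g))" if "k \<in> K" for k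
      using that K g assms by (auto simp: shift_apply m_assoc subset_iff)
    then show ?thesis using g assms by blast
  qed
  then show ?thesis
    using shift_config[OF orbit_closure_config[OF assms(1)] assms(2)]
    by (intro iffD2[OF mem_orbit_closure, OF conjI] allI impI)
qed

lemma base_in_orbit_closure: "x \<in> Y"
  unfolding mem_orbit_closure using base_config by (metis one_closed r_one subsetD)

lemma topspace_orbit_closure: "topspace Ytop = Y"
  unfolding orbit_closure_topology_def topspace_subtopology topspace_config
  using orbit_closure_config by blast

lemma compact_orbit_closure: "compact_space Ytop"
proof -
  have "compact_space (config_topology G A)"
    unfolding config_topology_def using finite_alphabet
    by (simp add: compact_space_product_topology compact_space_discrete_topology)
  then show ?thesis
    unfolding orbit_closure_topology_def orbit_closure_def
    by (intro compact_space_subtopology closedin_compact_space closedin_closure_of)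
qed

lemma open_orbit_closure_contains_cylinder:
  assumes "openin Ytop U" "y \<in> U"
  obtains K where "finite K" "K \<subseteq> carrier G"
    "\<And>z. z \<in> Y \<Longrightarrow> (\<And>k. k \<in> K \<Longrightarrow> z k = y k) \<Longrightarrow> z \<in> U"
proof -
  obtain V where V: "openin (config_topology G A) V" "U = V \<inter> Y"
    using assms(1) unfolding orbit_closure_topology_def openin_subtopology by blast
  obtain K where K: "finite K" "K \<subseteq> carrier G"
      "\<And>z. z \<in> carrier G \<rightarrow>\<^sub>E A \<Longrightarrow> (\<And>k. k \<in> K \<Longrightarrow> z k = y k) \<Longrightarrow> z \<in> V"
    using open_contains_cylinder[OF V(1)] assms(2) V(2) by blast
  show ?thesis using that[OF K(1,2)] K(3) V(2) orbit_closure_config by blast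
qed

section \<open>Sets that depend on finitely many coordinates\<close>

definition depends_on :: "'g set \<Rightarrow> ('g \<Rightarrow> 'a) set \<Rightarrow> bool" where
  "depends_on K C \<longleftrightarrow> C \<subseteq> Y \<and>
     (\<forall>y\<in>Y. \<forall>z\<in>Y. (\<forall>k\<in>K. y k = z k) \<longrightarrow> (y \<in> C \<longleftrightarrow> z \<in> C))"

definition local_sets :: "('g \<Rightarrow> 'a) set set" where
  "local_sets = {C. \<exists>K. finite K \<and> K \<subseteq> carrier G \<and> depends_on K C}"

lemma depends_onD:
  "depends_on K C \<Longrightarrow> y \<in> Y \<Longrightarrow> z \<in> Y \<Longrightarrow> (\<And>k. k \<in> K \<Longrightarrow> y k = z k) \<Longrightarrow> y \<in> C \<longleftrightarrow> z \<in> C"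
  unfolding depends_on_def by blast

lemma depends_onI:
  assumes "C \<subseteq> Y"
    and "\<And>y z. y \<in> Y \<Longrightarrow> z \<in> Y \<Longrightarrow> (\<And>k. k \<in> K \<Longrightarrow> y k = z k) \<Longrightarrow> y \<in> C \<Longrightarrow> z \<in> C"
  shows "depends_on K C"
  unfolding depends_on_def
proof (intro conjI ballI impI iffI assms(1))
  fix y z assume yz: "y \<in> Y" "z \<in> Y" "\<forall>k\<in>K. y k = z k"
  show "z \<in> C" if "y \<in> C" by (rule assms(2)[OF yz(1,2) _ that]) (rule bspec[OF yz(3)])
  show "y \<in> C" if "z \<in> C" by (rule assms(2)[OF yz(2,1) _ that]) (rule sym[OF bspec[OF yz(3)]])
qed

lemma local_setsI: "finite K \<Longrightarrow> K \<subseteq> carrier G \<Longrightarrow> depends_on K C \<Longrightarrow> C \<in> local_sets"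
  unfolding local_sets_def by blast

lemma local_setsE:
  assumes "C \<in> local_sets"
  obtains K where "finite K" "K \<subseteq> carrier G" "depends_on K C"
  using assms unfolding local_sets_def by blast

lemma local_sets_subset: "C \<in> local_sets \<Longrightarrow> C \<subseteq> Y"
  unfolding local_sets_def depends_on_def by blast

lemma depends_on_mono:
  assumes C: "depends_on K C" and KL: "K \<subseteq> L"
  shows "depends_on L C"
proof (rule depends_onI)
  show "C \<subseteq> Y" using C unfolding depends_on_def by (rule conjunct1)
  fix y z assume yz: "y \<in> Y" "z \<in> Y" "\<And>k. k \<in> L \<Longrightarrow> y k = z k" "y \<in> C"
  show "z \<in> C"
    by (rule iffD1[OF depends_onD[OF C yz(1,2) yz(3)] yz(4)]) (rule subsetD[OF KL])
qed

text \<open>These sets serve at the same time as the generator of the Borel sets, as the domain of the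
  premeasure, and, being clopen, as the sets to which compactness applies.\<close>

lemma algebra_local_sets: "algebra Y local_sets"
  unfolding algebra_iff_Un
proof (intro conjI ballI)
  show "local_sets \<subseteq> Pow Y" using local_sets_subset by blast
  show "{} \<in> local_sets" by (rule local_setsI[of "{}"]) (auto simp: depends_on_def)
  show "Y - C \<in> local_sets" if C: "C \<in> local_sets" for C
  proof -
    obtain K where K: "finite K" "K \<subseteq> carrier G" "depends_on K C" by (rule local_setsE[OF C])
    show ?thesis
    proof (rule local_setsI[OF K(1,2) depends_onI])
      fix y z assume yz: "y \<in> Y" "z \<in> Y" "\<And>k. k \<in> K \<Longrightarrow> y k = z k" "y \<in> Y - C"
      then show "z \<in> Y - C" using depends_onD[OF K(3) yz(1-3)] by simp
    qed simp
  qed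
  show "B \<union> C \<in> local_sets" if BC: "B \<in> local_sets" "C \<in> local_sets" for B C
  proof -
    obtain K where K: "finite K" "K \<subseteq> carrier G" "depends_on K B" by (rule local_setsE[OF BC(1)])
    obtain L where L: "finite L" "L \<subseteq> carrier G" "depends_on L C" by (rule local_setsE[OF BC(2)])
    have dep: "depends_on (K \<union> L) B" "depends_on (K \<union> L) C"
      using depends_on_mono[OF K(3)] depends_on_mono[OF L(3)] by simp_all
    have "depends_on (K \<union> L) (B \<union> C)"
    proof (rule depends_onI)
      show "B \<union> C \<subseteq> Y" using BC local_sets_subset by simp
      fix y z assume yz: "y \<in> Y" "z \<in> Y" "\<And>k. k \<in> K \<union> L \<Longrightarrow> y k = z k" "y \<in> B \<union> C"
      then show "z \<in> B \<union> C"
        using depends_onD[OF dep(1) yz(1-3)] depends_onD[OF dep(2) yz(1-3)] by simp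
    qed
    then show ?thesis using K L by (intro local_setsI[of "K \<union> L"]) auto
  qed
qed

lemma openin_local_set:
  assumes "C \<in> local_sets"
  shows "openin Ytop C"
proof -
  obtain K where K: "finite K" "K \<subseteq> carrier G" "depends_on K C" by (rule local_setsE[OF assms])
  have "C = (\<Union>y\<in>C. {z \<in> carrier G \<rightarrow>\<^sub>E A. \<forall>k\<in>K. z k = y k}) \<inter> Y"
  proof (intro equalityI subsetI)
    fix y assume "y \<in> C"
    then show "y \<in> (\<Union>y\<in>C. {z \<in> carrier G \<rightarrow>\<^sub>E A. \<forall>k\<in>K. z k = y k}) \<inter> Y"
      using local_sets_subset[OF assms] orbit_closure_config by blast
  next
    fix z assume z: "z \<in> (\<Union>y\<in>C. {z \<in> carrier G \<rightarrow>\<^sub>E A. \<forall>k\<in>K. z k = y k}) \<inter> Y"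
    then obtain y where "y \<in> C" "\<forall>k\<in>K. z k = y k" by auto
    then show "z \<in> C"
      using depends_onD[OF K(3), of z y] local_sets_subset[OF assms] z by auto
  qed
  moreover have "openin (config_topology G A) (\<Union>y\<in>C. {z \<in> carrier G \<rightarrow>\<^sub>E A. \<forall>k\<in>K. z k = y k})"
    using cylinder_open[OF K(1,2)] by (intro openin_Union) auto
  ultimately show ?thesis
    unfolding orbit_closure_topology_def openin_subtopology by (intro exI conjI)
qed

lemma closedin_local_set:
  assumes "C \<in> local_sets"
  shows "closedin Ytop C"
proof -
  interpret algebra Y local_sets by (rule algebra_local_sets)
  show ?thesis
    using openin_local_set[of "Y - C"] assms compl_sets local_sets_subset
    unfolding closedin_def topspace_orbit_closure by blast
qed

lemma preimage_local_set:
  assumes C: "C \<in> local_sets" and h: "h \<in> carrier G"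
  shows "{y \<in> Y. T h y \<in> C} \<in> local_sets"
proof -
  obtain K where K: "finite K" "K \<subseteq> carrier G" "depends_on K C" by (rule local_setsE[OF C])
  show ?thesis
  proof (rule local_setsI[of "(\<lambda>k. k \<otimes> h) ` K", OF _ _ depends_onI])
    show "finite ((\<lambda>k. k \<otimes> h) ` K)" "(\<lambda>k. k \<otimes> h) ` K \<subseteq> carrier G" using K h by auto
    fix y z assume yz: "y \<in> Y" "z \<in> Y" "y \<in> {y \<in> Y. T h y \<in> C}"
      and eq: "\<And>k. k \<in> (\<lambda>k. k \<otimes> h) ` K \<Longrightarrow> y k = z k"
    have "T h y k = T h z k" if "k \<in> K" for k
      using eq[OF imageI[OF that]] K(2) that by (simp add: shift_apply subset_iff)
    then show "z \<in> {y \<in> Y. T h y \<in> C}"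
      using depends_onD[OF K(3) shift_orbit_closure[OF yz(1) h] shift_orbit_closure[OF yz(2) h]] yz
      by simp
  qed simp
qed

text \<open>Exhaust \<open>G\<close> by finite sets \<open>K 0 \<subseteq> K 1 \<subseteq> \<dots>\<close>. An open set \<open>U\<close> is the countable union of the local
  sets of those points whose pattern on \<open>K n\<close> already forces membership in \<open>U\<close>. Countability of
  \<open>G\<close> is what makes the union countable.\<close>

lemma sigma_local_sets:
  assumes "countable (carrier G)"
  shows "sigma_sets Y local_sets = sigma_sets Y {U. openin Ytop U}"
proof (rule sigma_sets_eqI)
  show "C \<in> sigma_sets Y {U. openin Ytop U}" if "C \<in> local_sets" for C
    using that openin_local_set by (intro sigma_sets.Basic) simp
next
  fix U assume "U \<in> {U. openin Ytop U}"
  then have U: "openin Ytop U" by simp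
  define K where "K n = from_nat_into (carrier G) ` {..n}" for n :: nat
  have K: "finite (K n)" "K n \<subseteq> carrier G" for n
    unfolding K_def using from_nat_into[of "carrier G"] by auto
  define V where "V n = {y \<in> Y. \<forall>z\<in>Y. (\<forall>k\<in>K n. z k = y k) \<longrightarrow> z \<in> U}" for n
  have "V n \<in> local_sets" for n
  proof (rule local_setsI[OF K depends_onI])
    show "V n \<subseteq> Y" unfolding V_def by blast
    fix y z assume "z \<in> Y" "\<And>k. k \<in> K n \<Longrightarrow> y k = z k" "y \<in> V n"
    then show "z \<in> V n" unfolding V_def by simp
  qed
  moreover have "U = (\<Union>n. V n)"
  proof
    show "(\<Union>n. V n) \<subseteq> U" unfolding V_def by auto
    show "U \<subseteq> (\<Union>n. V n)"
    proof
      fix y assume y: "y \<in> U"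
      then have yY: "y \<in> Y" using U openin_subset topspace_orbit_closure by blast
      obtain L where L: "finite L" "L \<subseteq> carrier G"
        "\<And>z. z \<in> Y \<Longrightarrow> (\<And>k. k \<in> L \<Longrightarrow> z k = y k) \<Longrightarrow> z \<in> U"
        using open_orbit_closure_contains_cylinder[OF U y] by blast
      have "\<exists>n. L \<subseteq> K n"
      proof -
        have "L \<subseteq> from_nat_into (carrier G) ` (to_nat_on (carrier G) ` L)"
          using L(2) assms by (force simp: image_image from_nat_into_to_nat_on)
        moreover obtain n where "to_nat_on (carrier G) ` L \<subseteq> {..n}"
          using L(1) finite_nat_iff_bounded_le by (metis finite_imageI)
        ultimately show ?thesis unfolding K_def by blast
      qed
      then obtain n where "L \<subseteq> K n" by blast
      then have "y \<in> V n" using yY L(3) unfolding V_def by blast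
      then show "y \<in> (\<Union>n. V n)" by blast
    qed
  qed
  ultimately show "U \<in> sigma_sets Y local_sets"
    by (metis sigma_sets.Basic sigma_sets.Union)
qed

lemma sets_borel_orbit_closure:
  assumes "countable (carrier G)"
  shows "sets (borel_sigma Ytop) = sigma_sets Y local_sets"
  unfolding borel_sigma_def sigma_local_sets[OF assms] topspace_orbit_closure
  by (intro sets_measure_of) (use openin_subset topspace_orbit_closure in blast)

section \<open>Approximate periods\<close>

text \<open>Here \<open>P\<close> is a set on which \<open>x\<close> factors through the finite quotient given by \<open>\<phi>\<close>, and \<open>\<epsilon>\<close> bounds the
  proportion of classes outside \<open>P\<close>.\<close>

definition approximate_period :: "('g \<Rightarrow> 'c) \<Rightarrow> 'g set \<Rightarrow> 'g set \<Rightarrow> real \<Rightarrow> bool" where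
  "approximate_period \<phi> D P \<epsilon> \<longleftrightarrow> finite_congruence G \<phi> \<and> transversal G \<phi> D \<and> saturated G \<phi> P \<and>
     (\<forall>p\<in>P. \<forall>g\<in>carrier G. \<phi> p = \<phi> g \<longrightarrow> x g = x p) \<and> P \<subseteq> carrier G \<and>
     real (card (D - P)) \<le> \<epsilon> * real (card D)"

text \<open>Regularity supplies a subgroup of the skeleton whose periodic part has density above \<open>1 - \<epsilon>\<close>, and
  \<open>upper_banach_density_saturated_le\<close> turns this into a count of classes.\<close>

lemma regular_approximate_period:
  assumes reg: "regular_toeplitz G A x" and \<epsilon>: "\<epsilon> > 0"
  obtains H D P where "approximate_period (coset_action H) D P \<epsilon>"
proof -
  obtain H where sk: "skeleton G A x H" and sup: "(SUP n. upper_banach_density G (Per G (H n) x)) = 1"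
    using reg unfolding regular_toeplitz_def by blast
  have "1 - \<epsilon> < (SUP n. upper_banach_density G (Per G (H n) x))" using sup \<epsilon> by simp
  moreover have "bdd_above (range (\<lambda>n. upper_banach_density G (Per G (H n) x)))"
    using upper_banach_density_le_1 by (intro bdd_aboveI2)
  ultimately obtain n where n: "1 - \<epsilon> < upper_banach_density G (Per G (H n) x)"
    by (subst (asm) less_cSUP_iff) auto
  let ?H = "H n" and ?P = "Per G (H n) x"
  have fi: "finite_index_subgroup ?H G" using sk unfolding skeleton_def by blast
  then have sub: "subgroup ?H G" unfolding finite_index_subgroup_def by blast
  have cong: "finite_congruence G (coset_action ?H)" by (rule coset_action_congruence[OF fi])
  obtain D where D: "transversal G (coset_action ?H) D" by (rule transversal_exists)
  have PG: "?P \<subseteq> carrier G" unfolding Per_def by blast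
  have sat: "saturated G (coset_action ?H) ?P"
    unfolding saturated_def using Per_coset_action(1)[OF sub] by blast
  have fin: "finite D" "card D > 0" using transversal_finite[OF cong D] by auto
  have "1 - \<epsilon> < real (card {d \<in> D. d \<in> ?P}) / real (card D)"
    using n upper_banach_density_saturated_le[OF cong D sat] by linarith
  then have "(1 - \<epsilon>) * real (card D) < real (card {d \<in> D. d \<in> ?P})"
    using fin by (simp add: less_divide_eq)
  moreover have "card D = card {d \<in> D. d \<in> ?P} + card (D - ?P)"
    using fin card_Int_Diff[of D ?P] by (simp add: Int_def)
  ultimately have "real (card (D - ?P)) \<le> \<epsilon> * real (card D)"
    by (simp add: algebra_simps)
  then have "approximate_period (coset_action ?H) D ?P \<epsilon>"
    unfolding approximate_period_def
    using cong D sat PG Per_coset_action(2)[OF sub] by blast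
  then show ?thesis by (rule that)
qed

lemma approximate_period_finite:
  assumes "approximate_period \<phi> D P \<epsilon>"
  shows "finite D" "D \<noteq> {}" "D \<subseteq> carrier G" "card D > 0"
  using assms transversal_finite unfolding approximate_period_def transversal_def by blast+

lemma approximate_period_defect:
  assumes ap: "approximate_period \<phi> D P \<epsilon>" and "h \<in> carrier G" "k \<in> carrier G"
  shows "card {d \<in> D. h \<otimes> d \<otimes> k \<notin> P} = card (D - P)"
proof -
  have D: "D \<subseteq> carrier G" by (rule approximate_period_finite[OF ap])
  have "finite_congruence G \<phi>" "transversal G \<phi> D" "saturated G \<phi> (carrier G - P)"
    using ap saturated_diff unfolding approximate_period_def by blast+
  note equi = equidistribution[OF this]
  have "card {d \<in> D. h \<otimes> d \<otimes> k \<in> carrier G - P} = card {d \<in> D. \<one> \<otimes> d \<otimes> \<one> \<in> carrier G - P}"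
    using equi[OF assms(2,3)] equi[OF one_closed one_closed] by simp
  moreover have "{d \<in> D. h \<otimes> d \<otimes> k \<in> carrier G - P} = {d \<in> D. h \<otimes> d \<otimes> k \<notin> P}"
    using D assms by auto
  moreover have "{d \<in> D. \<one> \<otimes> d \<otimes> \<one> \<in> carrier G - P} = D - P"
    using D by auto
  ultimately show ?thesis by simp
qed

text \<open>For a point of the orbit itself one takes the representative of the class of the translating
  element. A general \<open>y\<close> looks like an orbit point on every finite set; if each \<open>d \<in> D\<close> were refuted at
  some position, the finitely many refuting positions would together contradict this.\<close>

lemma orbit_closure_periodic_part:
  assumes ap: "approximate_period \<phi> D P \<epsilon>" and y: "y \<in> Y"
  obtains d where "d \<in> D" "\<And>h. h \<in> carrier G \<Longrightarrow> h \<otimes> d \<in> P \<Longrightarrow> y h = x (h \<otimes> d)"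
proof -
  have \<phi>: "finite_congruence G \<phi>" and D: "transversal G \<phi> D"
    and per: "\<And>p g. p \<in> P \<Longrightarrow> g \<in> carrier G \<Longrightarrow> \<phi> p = \<phi> g \<Longrightarrow> x g = x p"
    using ap unfolding approximate_period_def by blast+
  have "\<exists>d\<in>D. \<forall>h\<in>carrier G. h \<otimes> d \<in> P \<longrightarrow> y h = x (h \<otimes> d)"
  proof (rule ccontr)
    assume "\<not> ?thesis"
    then have "\<forall>d\<in>D. \<exists>h\<in>carrier G. h \<otimes> d \<in> P \<and> y h \<noteq> x (h \<otimes> d)" by blast
    then obtain h where h: "\<forall>d\<in>D. h d \<in> carrier G \<and> h d \<otimes> d \<in> P \<and> y (h d) \<noteq> x (h d \<otimes> d)"
      by metis
    then have "finite (h ` D)" "h ` D \<subseteq> carrier G" using approximate_period_finite[OF ap] by auto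
    then obtain g where g: "g \<in> carrier G" "\<forall>k\<in>h ` D. y k = x (k \<otimes> g)"
      using y mem_orbit_closure by blast
    obtain d where d: "d \<in> D" "d \<in> carrier G" "\<phi> d = \<phi> g"
      by (rule transversal_rep[OF D g(1)])
    have "\<phi> (h d \<otimes> d) = \<phi> (h d \<otimes> g)"
      using congruence_left[OF \<phi> d(3)] d g h by blast
    then have "x (h d \<otimes> g) = x (h d \<otimes> d)"
      using per h d g by (metis m_closed)
    then show False using h d g by auto
  qed
  then show ?thesis using that by blast
qed

text \<open>Replace \<open>y\<close> by a translate of \<open>x\<close> as in \<open>orbit_closure_periodic_part\<close>. Whether \<open>f\<close> counts can be
  read off in the finite quotient unless one of the positions \<open>k \<otimes> h \<otimes> f \<otimes> d\<close> with \<open>k \<in> K\<close> lies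
  outside \<open>P\<close>; for each \<open>k\<close> this affects a proportion of at most \<open>\<epsilon>\<close> of \<open>D\<close>. What is read off in the
  quotient, the saturated set \<open>B\<close> of the proof, is counted by equidistribution, so \<open>h\<close> and \<open>y\<close> do not
  influence the result.\<close>

lemma uniform_average:
  assumes ap: "approximate_period \<phi> D P \<epsilon>"
    and K: "finite K" "K \<subseteq> carrier G" and C: "depends_on K C"
  shows "\<exists>\<alpha>. \<forall>h\<in>carrier G. \<forall>y\<in>Y.
    \<bar>real (card {f \<in> D. T (h \<otimes> f) y \<in> C}) / real (card D) - \<alpha>\<bar> \<le> real (card K) * \<epsilon>"
proof -
  have \<phi>: "finite_congruence G \<phi>" and D: "transversal G \<phi> D" and P: "saturated G \<phi> P"
    and per: "\<And>p g. p \<in> P \<Longrightarrow> g \<in> carrier G \<Longrightarrow> \<phi> p = \<phi> g \<Longrightarrow> x g = x p"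
    and le: "real (card (D - P)) \<le> \<epsilon> * real (card D)" and PG: "P \<subseteq> carrier G"
    using ap unfolding approximate_period_def by blast+
  note D' = approximate_period_finite[OF ap]
  define B where "B = {c \<in> carrier G. (\<forall>k\<in>K. k \<otimes> c \<in> P) \<and> T c x \<in> C}"
  \<comment> \<open>Within a class the translates of \<open>x\<close> agree on \<open>K\<close>, and \<open>C\<close> sees no other coordinates.\<close>
  have B: "saturated G \<phi> B"
    unfolding saturated_def
  proof (intro ballI impI)
    fix g g' assume g: "g \<in> carrier G" "g' \<in> carrier G" "\<phi> g = \<phi> g'" "g \<in> B"
    have eq: "\<phi> (k \<otimes> g) = \<phi> (k \<otimes> g')" if "k \<in> K" for k
      using congruence_left[OF \<phi> g(3)] g that K by blast
    have kP: "k \<otimes> g \<in> P" if "k \<in> K" for k using g(4) that unfolding B_def by blast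
    have "k \<otimes> g' \<in> P" if "k \<in> K" for k
      using saturatedD[OF P kP eq] that g K by blast
    moreover have "T g' x k = T g x k" if "k \<in> K" for k
      using per[OF kP _ eq] that g K by (auto simp: shift_apply subset_iff)
    then have "T g' x \<in> C \<longleftrightarrow> T g x \<in> C"
      by (intro depends_onD[OF C] shift_orbit_closure base_in_orbit_closure g)
    ultimately show "g' \<in> B" using g unfolding B_def by blast
  qed
  define \<alpha> where "\<alpha> = real (card (\<phi> ` (B \<inter> carrier G))) / real (card D)"
  have "\<bar>real (card {f \<in> D. T (h \<otimes> f) y \<in> C}) / real (card D) - \<alpha>\<bar> \<le> real (card K) * \<epsilon>"
    if h: "h \<in> carrier G" and y: "y \<in> Y" for h y
  proof -
    obtain d where d: "d \<in> D" "\<And>h. h \<in> carrier G \<Longrightarrow> h \<otimes> d \<in> P \<Longrightarrow> y h = x (h \<otimes> d)"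
      using orbit_closure_periodic_part[OF ap y] by blast
    have dc: "d \<in> carrier G" using d D' by blast
    let ?S = "{f \<in> D. T (h \<otimes> f) y \<in> C}" and ?R = "{f \<in> D. h \<otimes> f \<otimes> d \<in> B}"
      and ?E = "\<Union>k\<in>K. {f \<in> D. (k \<otimes> h) \<otimes> f \<otimes> d \<notin> P}"
    have same: "f \<in> ?S \<longleftrightarrow> f \<in> ?R" if f: "f \<in> D" "f \<notin> ?E" for f
    proof -
      have fc: "f \<in> carrier G" using f D' by blast
      have kP: "k \<otimes> (h \<otimes> f \<otimes> d) \<in> P" if "k \<in> K" for k
        using f that K h fc dc by (auto simp: m_assoc subset_iff)
      have "T (h \<otimes> f) y k = T (h \<otimes> f \<otimes> d) x k" if k: "k \<in> K" for k
      proof -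
        have "k \<otimes> (h \<otimes> f) \<otimes> d = k \<otimes> (h \<otimes> f \<otimes> d)" using k K h fc dc by (auto simp: m_assoc subset_iff)
        then show ?thesis using d(2)[of "k \<otimes> (h \<otimes> f)"] kP[OF k] k K h fc dc
          by (auto simp: shift_apply subset_iff)
      qed
      then have "T (h \<otimes> f) y \<in> C \<longleftrightarrow> T (h \<otimes> f \<otimes> d) x \<in> C"
        using h fc dc y by (intro depends_onD[OF C] shift_orbit_closure base_in_orbit_closure) auto
      then show ?thesis using f kP h fc dc unfolding B_def by auto
    qed
    have RE: "f \<notin> ?R" if "f \<in> ?E" for f
      using that h dc K D' unfolding B_def by (auto simp: m_assoc subset_iff)
    have finE: "finite ?E" using K D' by auto
    have "?R \<subseteq> ?S" using same RE by blast
    then have 1: "card ?R \<le> card ?S" using D' by (intro card_mono) auto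
    have "?S \<subseteq> ?R \<union> ?E" using same by blast
    then have "card ?S \<le> card (?R \<union> ?E)" using D' finE by (intro card_mono) auto
    also have "\<dots> \<le> card ?R + card ?E" by (rule card_Un_le)
    also have "card ?E \<le> (\<Sum>k\<in>K. card {f \<in> D. (k \<otimes> h) \<otimes> f \<otimes> d \<notin> P})"
      by (rule card_UN_le[OF K(1)])
    also have "\<dots> = (\<Sum>k\<in>K. card (D - P))"
      using approximate_period_defect[OF ap] K h dc by (intro sum.cong) auto
    finally have "real (card ?S) \<le> real (card ?R) + real (card K) * real (card (D - P))"
      by (simp flip: of_nat_mult of_nat_add)
    also have "\<dots> \<le> real (card ?R) + real (card K) * (\<epsilon> * real (card D))"
      using le by (intro add_left_mono mult_left_mono) auto
    finally have 2: "real (card ?S) \<le> real (card ?R) + real (card K) * \<epsilon> * real (card D)" by simp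
    have "real (card ?R) / real (card D) = \<alpha>"
      unfolding \<alpha>_def using equidistribution[OF \<phi> D B h dc] by simp
    then have "\<bar>real (card ?S) / real (card D) - \<alpha>\<bar> = (real (card ?S) - real (card ?R)) / real (card D)"
      using 1 by (auto simp: diff_divide_distrib abs_of_nonneg divide_right_mono)
    also have "\<dots> \<le> real (card K) * \<epsilon>" using 2 D'(4) by (simp add: divide_le_eq)
    finally show ?thesis .
  qed
  then show ?thesis by blast
qed

end
section \<open>Unique ergodicity\<close>

lemma average_close:
  fixes u :: "'i \<Rightarrow> real"
  assumes "finite I" "I \<noteq> {}" and close: "\<And>i. i \<in> I \<Longrightarrow> \<bar>u i - a\<bar> \<le> b"
  shows "\<bar>(\<Sum>i\<in>I. u i) / real (card I) - a\<bar> \<le> b"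
proof -
  have c: "real (card I) > 0" using assms by (simp add: card_gt_0_iff)
  have "\<bar>\<Sum>i\<in>I. u i - a\<bar> \<le> real (card I) * b"
    using sum_norm_bound[of I "\<lambda>i. u i - a" b] close by simp
  moreover have "(\<Sum>i\<in>I. u i) / real (card I) - a = (\<Sum>i\<in>I. u i - a) / real (card I)"
    using c by (simp add: sum_subtractf field_simps)
  ultimately show ?thesis using c by (simp add: divide_le_eq mult.commute)
qed

context shift_orbit
begin

definition freq :: "'g set \<Rightarrow> 'g \<Rightarrow> ('g \<Rightarrow> 'a) \<Rightarrow> ('g \<Rightarrow> 'a) set \<Rightarrow> real" where
  "freq D h y C = real (card {f \<in> D. T (h \<otimes> f) y \<in> C}) / real (card D)"

lemma freq_sum:
  assumes "finite D"
  shows "freq D h y C = (\<Sum>f\<in>D. if T (h \<otimes> f) y \<in> C then 1 else 0) / real (card D)"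
  unfolding freq_def using assms by (simp add: sum.If_cases Int_def)

end

text \<open>The sets \<open>D n\<close> average every local set uniformly over the orbit closure and over all left
  translates of \<open>D n\<close>. Uniformity in \<open>h\<close> makes the averages invariant, and also comparable with
  each other although the \<open>D n\<close> are unrelated for different \<open>n\<close>.\<close>

locale averaging_orbit = shift_orbit G A x for G :: "('g, 'b) monoid_scheme" (structure)
    and A :: "'a set" and x :: "'g \<Rightarrow> 'a" +
  fixes D :: "nat \<Rightarrow> 'g set"
  assumes countable_carrier: "countable (carrier G)"
    and D_finite: "finite (D n)" and D_nonempty: "D n \<noteq> {}" and D_carrier: "D n \<subseteq> carrier G"
    and uniform: "C \<in> local_sets \<Longrightarrow>
      \<exists>c. \<forall>n. \<exists>\<alpha>. \<forall>h\<in>carrier G. \<forall>y\<in>Y. \<bar>freq (D n) h y C - \<alpha>\<bar> \<le> c * inverse (real (Suc n))"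
begin

text \<open>The almost constant values \<open>\<alpha> n\<close> form a Cauchy sequence: the average over all products \<open>d \<otimes> e\<close> with
  \<open>d \<in> D n\<close> and \<open>e \<in> D m\<close> is close to \<open>\<alpha> n\<close> when \<open>d\<close> runs first, by uniformity in the point, and close
  to \<open>\<alpha> m\<close> when \<open>e\<close> runs first, by uniformity in the left translation.\<close>

lemma uniform_limit:
  assumes C: "C \<in> local_sets"
  shows "\<exists>m. \<forall>e>0. \<forall>\<^sub>F n in sequentially. \<forall>h\<in>carrier G. \<forall>y\<in>Y. \<bar>freq (D n) h y C - m\<bar> < e"
proof -
  obtain c where c: "\<forall>n. \<exists>\<alpha>. \<forall>h\<in>carrier G. \<forall>y\<in>Y. \<bar>freq (D n) h y C - \<alpha>\<bar> \<le> c * inverse (real (Suc n))"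
    using uniform[OF C] by blast
  obtain \<alpha> where \<alpha>: "\<And>n h y. h \<in> carrier G \<Longrightarrow> y \<in> Y \<Longrightarrow>
      \<bar>freq (D n) h y C - \<alpha> n\<bar> \<le> c * inverse (real (Suc n))"
    using choice[OF c] by blast
  define b where "b n = c * inverse (real (Suc n))" for n
  have b: "b \<longlonglongrightarrow> 0"
    unfolding b_def using tendsto_mult[OF tendsto_const[of c] LIMSEQ_inverse_real_of_nat] by simp
  have cross: "\<bar>\<alpha> n - \<alpha> m\<bar> \<le> b n + b m" for n m
  proof -
    let ?w = "\<lambda>d e. if T (d \<otimes> e) x \<in> C then 1 else 0 :: real"
    have e: "freq (D n) \<one> (T e x) C = (\<Sum>d\<in>D n. ?w d e) / real (card (D n))" if "e \<in> D m" for e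
      unfolding freq_sum[OF D_finite] using that D_carrier[of n] D_carrier[of m]
      by (intro arg_cong2[of _ _ _ _ "(/)"] sum.cong refl) (auto simp: shift_shift subset_iff)
    have d: "freq (D m) d x C = (\<Sum>e\<in>D m. ?w d e) / real (card (D m))" for d
      by (rule freq_sum[OF D_finite])
    have "(\<Sum>e\<in>D m. freq (D n) \<one> (T e x) C) / real (card (D m))
        = (\<Sum>e\<in>D m. \<Sum>d\<in>D n. ?w d e) / (real (card (D n)) * real (card (D m)))"
      by (simp add: e sum_divide_distrib[symmetric])
    also have "(\<Sum>e\<in>D m. \<Sum>d\<in>D n. ?w d e) = (\<Sum>d\<in>D n. \<Sum>e\<in>D m. ?w d e)"
      by (rule sum.swap)
    also have "\<dots> / (real (card (D n)) * real (card (D m)))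
        = (\<Sum>d\<in>D n. freq (D m) d x C) / real (card (D n))"
      by (simp add: d sum_divide_distrib[symmetric] mult.commute)
    finally have eq: "(\<Sum>e\<in>D m. freq (D n) \<one> (T e x) C) / real (card (D m))
        = (\<Sum>d\<in>D n. freq (D m) d x C) / real (card (D n))" .
    have "\<bar>(\<Sum>e\<in>D m. freq (D n) \<one> (T e x) C) / real (card (D m)) - \<alpha> n\<bar> \<le> b n"
      unfolding b_def using D_carrier[of m]
      by (intro average_close D_finite D_nonempty \<alpha> one_closed shift_orbit_closure base_in_orbit_closure) blast
    moreover have "\<bar>(\<Sum>d\<in>D n. freq (D m) d x C) / real (card (D n)) - \<alpha> m\<bar> \<le> b m"
      unfolding b_def using D_carrier[of n]
      by (intro average_close D_finite D_nonempty \<alpha> base_in_orbit_closure) blast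
    ultimately show ?thesis unfolding eq by linarith
  qed
  have "Cauchy \<alpha>"
  proof (rule metric_CauchyI)
    fix e :: real assume "e > 0"
    then have "\<forall>\<^sub>F n in sequentially. b n < e / 2" using order_tendstoD(2)[OF b, of "e / 2"] by simp
    then obtain N where N: "\<And>n. n \<ge> N \<Longrightarrow> b n < e / 2" unfolding eventually_sequentially by blast
    have "dist (\<alpha> m) (\<alpha> n) < e" if "m \<ge> N" "n \<ge> N" for m n
      using cross[of m n] N[OF that(1)] N[OF that(2)] by (simp add: dist_real_def)
    then show "\<exists>M. \<forall>m\<ge>M. \<forall>n\<ge>M. dist (\<alpha> m) (\<alpha> n) < e" by blast
  qed
  then obtain m where m: "\<alpha> \<longlonglongrightarrow> m" using Cauchy_convergent convergentD by blast
  have "\<forall>\<^sub>F n in sequentially. \<forall>h\<in>carrier G. \<forall>y\<in>Y. \<bar>freq (D n) h y C - m\<bar> < e" if e: "e > 0" for e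
  proof -
    have "\<forall>\<^sub>F n in sequentially. b n < e / 2" using order_tendstoD(2)[OF b, of "e / 2"] e by simp
    moreover have "\<forall>\<^sub>F n in sequentially. dist (\<alpha> n) m < e / 2" using tendstoD[OF m, of "e / 2"] e by simp
    ultimately show ?thesis
    proof eventually_elim
      case (elim n)
      then have "\<bar>freq (D n) h y C - m\<bar> < e" if "h \<in> carrier G" "y \<in> Y" for h y
        using \<alpha>[OF that, of n] unfolding b_def dist_real_def by linarith
      then show ?case by blast
    qed
  qed
  then show ?thesis by blast
qed

definition mean :: "('g \<Rightarrow> 'a) set \<Rightarrow> real" where
  "mean C = lim (\<lambda>n. freq (D n) \<one> x C)"

lemma mean_uniform:
  assumes C: "C \<in> local_sets" and e: "e > 0"
  shows "\<forall>\<^sub>F n in sequentially. \<forall>h\<in>carrier G. \<forall>y\<in>Y. \<bar>freq (D n) h y C - mean C\<bar> < e"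
proof -
  obtain m where m: "\<And>e. e > 0 \<Longrightarrow>
      \<forall>\<^sub>F n in sequentially. \<forall>h\<in>carrier G. \<forall>y\<in>Y. \<bar>freq (D n) h y C - m\<bar> < e"
    using uniform_limit[OF C] by blast
  have "(\<lambda>n. freq (D n) \<one> x C) \<longlonglongrightarrow> m"
  proof (rule tendstoI)
    fix e :: real assume "e > 0"
    from m[OF this] show "\<forall>\<^sub>F n in sequentially. dist (freq (D n) \<one> x C) m < e"
      by eventually_elim (simp add: dist_real_def base_in_orbit_closure)
  qed
  then have "mean C = m" unfolding mean_def by (rule limI)
  then show ?thesis using m[OF e] by simp
qed

lemma freq_tendsto:
  assumes C: "C \<in> local_sets" and "h \<in> carrier G" "y \<in> Y"
  shows "(\<lambda>n. freq (D n) h y C) \<longlonglongrightarrow> mean C"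
proof (rule tendstoI)
  fix e :: real assume "e > 0"
  from mean_uniform[OF C this] show "\<forall>\<^sub>F n in sequentially. dist (freq (D n) h y C) (mean C) < e"
    by eventually_elim (use assms in \<open>simp add: dist_real_def\<close>)
qed

lemma mean_eqI:
  assumes "C \<in> local_sets" "h \<in> carrier G" "y \<in> Y" "(\<lambda>n. freq (D n) h y C) \<longlonglongrightarrow> m"
  shows "mean C = m"
  using LIMSEQ_unique[OF freq_tendsto[OF assms(1-3)] assms(4)] .

lemma mean_nonneg: "C \<in> local_sets \<Longrightarrow> 0 \<le> mean C"
  by (rule LIMSEQ_le_const[OF freq_tendsto[OF _ one_closed base_in_orbit_closure]])
     (auto simp: freq_def)

lemma local_sets_empty: "{} \<in> local_sets" and local_sets_space: "Y \<in> local_sets"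
proof -
  interpret algebra Y local_sets by (rule algebra_local_sets)
  show "{} \<in> local_sets" by simp
  show "Y \<in> local_sets" by simp
qed

lemma mean_empty: "mean {} = 0"
  by (rule mean_eqI[OF local_sets_empty one_closed base_in_orbit_closure]) (simp add: freq_def)

lemma mean_space: "mean Y = 1"
proof (rule mean_eqI[OF local_sets_space one_closed base_in_orbit_closure])
  have "{f \<in> D n. T (\<one> \<otimes> f) x \<in> Y} = D n" for n
    using D_carrier[of n] shift_orbit_closure[OF base_in_orbit_closure] by auto
  then show "(\<lambda>n. freq (D n) \<one> x Y) \<longlonglongrightarrow> 1"
    unfolding freq_def using D_finite D_nonempty by simp
qed

lemma mean_Un:
  assumes B: "B \<in> local_sets" and C: "C \<in> local_sets" and "B \<inter> C = {}"
  shows "mean (B \<union> C) = mean B + mean C"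
proof -
  interpret algebra Y local_sets by (rule algebra_local_sets)
  have "freq (D n) \<one> x (B \<union> C) = freq (D n) \<one> x B + freq (D n) \<one> x C" for n
  proof -
    have "{f \<in> D n. T (\<one> \<otimes> f) x \<in> B \<union> C}
        = {f \<in> D n. T (\<one> \<otimes> f) x \<in> B} \<union> {f \<in> D n. T (\<one> \<otimes> f) x \<in> C}" by auto
    also have "card \<dots> = card {f \<in> D n. T (\<one> \<otimes> f) x \<in> B} + card {f \<in> D n. T (\<one> \<otimes> f) x \<in> C}"
      using assms(3) D_finite by (intro card_Un_disjoint) auto
    finally show ?thesis unfolding freq_def by (simp add: add_divide_distrib)
  qed
  then show ?thesis
    using tendsto_add[OF freq_tendsto[OF B one_closed base_in_orbit_closure]
        freq_tendsto[OF C one_closed base_in_orbit_closure]]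
    by (intro mean_eqI[OF Un[OF B C] one_closed base_in_orbit_closure]) simp
qed

text \<open>Translating by \<open>h\<close> first replaces \<open>D n\<close> by \<open>h D n\<close>, which has the same limit frequencies.\<close>

lemma mean_preimage:
  assumes C: "C \<in> local_sets" and h: "h \<in> carrier G"
  shows "mean {y \<in> Y. T h y \<in> C} = mean C"
proof (rule mean_eqI[OF preimage_local_set[OF C h] one_closed base_in_orbit_closure])
  have "{f \<in> D n. T (\<one> \<otimes> f) x \<in> {y \<in> Y. T h y \<in> C}} = {f \<in> D n. T (h \<otimes> f) x \<in> C}" for n
    using D_carrier[of n] shift_orbit_closure[OF base_in_orbit_closure] h
    by (auto simp: shift_shift subset_iff)
  then have "freq (D n) \<one> x {y \<in> Y. T h y \<in> C} = freq (D n) h x C" for n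
    unfolding freq_def by simp
  then show "(\<lambda>n. freq (D n) \<one> x {y \<in> Y. T h y \<in> C}) \<longlonglongrightarrow> mean C"
    using freq_tendsto[OF C h base_in_orbit_closure] by simp
qed

text \<open>By invariance, integrating the frequency \<open>y \<mapsto> freq (D n) \<one> y C\<close> gives the measure of \<open>C\<close>, and this
  function is uniformly close to the constant \<open>mean C\<close>.\<close>

lemma invariant_measure_eq_mean:
  assumes \<mu>: "invariant_borel_prob G Ytop T \<mu>" and C: "C \<in> local_sets"
  shows "measure \<mu> C = mean C"
proof -
  interpret prob_space \<mu> using \<mu> unfolding invariant_borel_prob_def by blast
  have sets: "sets \<mu> = sigma_sets Y local_sets"
    using \<mu> sets_borel_orbit_closure[OF countable_carrier] unfolding invariant_borel_prob_def by simp
  have space: "space \<mu> = Y"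
    using \<mu> sets_eq_imp_space_eq[of \<mu> "borel_sigma Ytop"]
    unfolding invariant_borel_prob_def borel_sigma_def
    by (simp add: space_measure_of_conv topspace_orbit_closure)
  have pre: "{y \<in> Y. T f y \<in> C} \<in> sets \<mu>" if "f \<in> carrier G" for f
    unfolding sets by (intro sigma_sets.Basic preimage_local_set C that)
  have inv: "measure \<mu> {y \<in> Y. T f y \<in> C} = measure \<mu> C" if "f \<in> carrier G" for f
  proof -
    have "C \<in> sets \<mu>" unfolding sets by (rule sigma_sets.Basic[OF C])
    then have "emeasure \<mu> {y \<in> topspace Ytop. T f y \<in> C} = emeasure \<mu> C"
      using \<mu> that unfolding invariant_borel_prob_def by blast
    then show ?thesis unfolding topspace_orbit_closure measure_def by simp
  qed
  have close: "\<bar>measure \<mu> C - mean C\<bar> \<le> e" if e: "e > 0" for e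
  proof -
    obtain n where n: "\<And>h y. h \<in> carrier G \<Longrightarrow> y \<in> Y \<Longrightarrow> \<bar>freq (D n) h y C - mean C\<bar> < e"
      using mean_uniform[OF C e] unfolding eventually_sequentially by blast
    \<comment> \<open>The frequency, written as a combination of indicators of measurable sets on the whole type.\<close>
    define \<psi> where "\<psi> y = (\<Sum>f\<in>D n. indicator {y \<in> Y. T f y \<in> C} y) / real (card (D n))" for y :: "'g \<Rightarrow> 'a"
    have int: "integrable \<mu> (\<lambda>y. indicator {y \<in> Y. T f y \<in> C} y :: real)" if "f \<in> D n" for f
      using pre that D_carrier[of n] by (intro integrable_real_indicator) (auto simp: emeasure_eq_measure)
    then have int\<psi>: "integrable \<mu> \<psi>" unfolding \<psi>_def by (intro integrable_divide Bochner_Integration.integrable_sum)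
    have "integral\<^sup>L \<mu> \<psi> = (\<Sum>f\<in>D n. integral\<^sup>L \<mu> (\<lambda>y. indicator {y \<in> Y. T f y \<in> C} y)) / real (card (D n))"
      unfolding \<psi>_def using int by (simp add: Bochner_Integration.integral_sum)
    also have "\<dots> = (\<Sum>f\<in>D n. measure \<mu> C) / real (card (D n))"
      using pre inv D_carrier[of n] by (intro arg_cong2[of _ _ _ _ "(/)"] sum.cong refl) auto
    also have "\<dots> = measure \<mu> C" using D_finite D_nonempty by simp
    finally have I: "integral\<^sup>L \<mu> \<psi> = measure \<mu> C" .
    have "\<psi> y = freq (D n) \<one> y C" if y: "y \<in> space \<mu>" for y
      unfolding \<psi>_def freq_sum[OF D_finite] using y space D_carrier[of n]
      by (intro arg_cong2[of _ _ _ _ "(/)"] sum.cong refl) (auto simp: indicator_def subset_iff)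
    then have b: "\<bar>\<psi> y - mean C\<bar> < e" if "y \<in> space \<mu>" for y
      using n[OF one_closed, of y] that space by simp
    have "integral\<^sup>L \<mu> \<psi> \<le> mean C + e"
      using b by (intro integral_le_const int\<psi> AE_I2) fastforce
    moreover have "mean C - e \<le> integral\<^sup>L \<mu> \<psi>"
      using b by (intro integral_ge_const int\<psi> AE_I2) fastforce
    ultimately show ?thesis unfolding I by linarith
  qed
  show ?thesis
  proof (rule ccontr)
    assume "measure \<mu> C \<noteq> mean C"
    then show False using close[of "\<bar>measure \<mu> C - mean C\<bar> / 2"] by simp
  qed
qed

lemma measure_eqI_local_sets:
  assumes "prob_space \<mu>" "sets \<mu> = sigma_sets Y local_sets" "sets \<nu> = sigma_sets Y local_sets"
    and eq: "\<And>C. C \<in> local_sets \<Longrightarrow> emeasure \<mu> C = emeasure \<nu> C"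
  shows "\<mu> = \<nu>"
proof -
  interpret algebra Y local_sets by (rule algebra_local_sets)
  interpret prob_space \<mu> by (rule assms(1))
  show ?thesis
    by (rule measure_eqI_generator_eq[OF _ _ eq assms(2,3), of "\<lambda>_. Y"])
       (auto simp: Int_stable_def space_closed local_sets_space emeasure_eq_measure dest: local_sets_subset)
qed

text \<open>A decreasing sequence of closed local sets with empty intersection is eventually empty by
  compactness, so continuity of the premeasure at the empty set holds for trivial reasons.\<close>

lemma mean_premeasure_extends:
  "\<exists>\<nu>. sets \<nu> = sigma_sets Y local_sets \<and> space \<nu> = Y \<and>
    (\<forall>C\<in>local_sets. emeasure \<nu> C = ennreal (mean C))"
proof -
  interpret algebra Y local_sets by (rule algebra_local_sets)
  have "\<exists>\<nu> :: ('g \<Rightarrow> 'a) set \<Rightarrow> ennreal. (\<forall>C\<in>local_sets. \<nu> C = ennreal (mean C)) \<and>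
      measure_space Y (sigma_sets Y local_sets) \<nu>"
  proof (rule caratheodory_empty_continuous)
    show "positive local_sets (\<lambda>C. ennreal (mean C))"
      unfolding positive_def by (simp add: mean_empty)
    show "additive local_sets (\<lambda>C. ennreal (mean C))"
      unfolding additive_def by (simp add: mean_Un mean_nonneg)
    show "ennreal (mean C) \<noteq> \<infinity>" for C by simp
    fix B :: "nat \<Rightarrow> ('g \<Rightarrow> 'a) set"
    assume B: "range B \<subseteq> local_sets" "decseq B" "(\<Inter>i. B i) = {}"
    have "\<exists>N. B N = {}"
      using compact_space_imp_nest[OF compact_orbit_closure, of B] B closedin_local_set by blast
    then obtain N where N: "B N = {}" by blast
    have "ennreal (mean (B n)) = 0" if "n \<ge> N" for n
      using decseqD[OF B(2) that] N mean_empty by simp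
    then have "\<forall>\<^sub>F n in sequentially. ennreal (mean (B n)) = 0"
      unfolding eventually_sequentially by blast
    then show "(\<lambda>n. ennreal (mean (B n))) \<longlonglongrightarrow> 0" by (rule tendsto_eventually)
  qed
  then obtain \<nu>0 :: "('g \<Rightarrow> 'a) set \<Rightarrow> ennreal" where \<nu>0: "\<And>C. C \<in> local_sets \<Longrightarrow> \<nu>0 C = ennreal (mean C)"
    and ms: "measure_space Y (sigma_sets Y local_sets) \<nu>0" by blast
  define \<nu> where "\<nu> = measure_of Y local_sets \<nu>0"
  have sets: "sets \<nu> = sigma_sets Y local_sets"
    unfolding \<nu>_def by (rule sets_measure_of[OF space_closed])
  have "emeasure \<nu> C = ennreal (mean C)" if "C \<in> local_sets" for C
    using emeasure_measure_of[OF \<nu>_def space_closed, of C] ms that \<nu>0 sets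
    unfolding measure_space_def by auto
  then show ?thesis
    using sets by (intro exI[of _ \<nu>]) (simp add: \<nu>_def space_measure_of[OF space_closed])
qed

lemma invariant_measure_exists: "\<exists>\<mu>. invariant_borel_prob G Ytop T \<mu>"
proof -
  interpret algebra Y local_sets by (rule algebra_local_sets)
  obtain \<mu> :: "('g \<Rightarrow> 'a) measure" where sets: "sets \<mu> = sigma_sets Y local_sets" and space: "space \<mu> = Y"
    and em: "\<And>C. C \<in> local_sets \<Longrightarrow> emeasure \<mu> C = ennreal (mean C)"
    using mean_premeasure_extends by blast
  have prob: "prob_space \<mu>"
    by (rule prob_spaceI) (simp add: space em local_sets_space mean_space)
  have "emeasure \<mu> {y \<in> topspace Ytop. T h y \<in> B} = emeasure \<mu> B"
    if h: "h \<in> carrier G" and B: "B \<in> sets \<mu>" for h B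
  proof -
    have pre: "T h -` C \<inter> space \<mu> = {y \<in> Y. T h y \<in> C}" for C unfolding space by auto
    have "T h \<in> measurable \<mu> (sigma Y local_sets)"
    proof (rule measurable_measure_of[OF space_closed])
      show "T h \<in> space \<mu> \<rightarrow> Y" using shift_orbit_closure h space by auto
      show "T h -` C \<inter> space \<mu> \<in> sets \<mu>" if "C \<in> local_sets" for C
        unfolding pre sets by (intro sigma_sets.Basic preimage_local_set that h)
    qed
    also have "measurable \<mu> (sigma Y local_sets) = measurable \<mu> \<mu>"
      by (rule measurable_cong_sets) (simp_all add: sets sets_measure_of[OF space_closed])
    finally have meas: "T h \<in> measurable \<mu> \<mu>" .
    have "\<mu> = distr \<mu> \<mu> (T h)"
    proof (rule measure_eqI_local_sets[OF prob sets])
      show "sets (distr \<mu> \<mu> (T h)) = sigma_sets Y local_sets" using sets by simp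
      fix C assume C: "C \<in> local_sets"
      then have "C \<in> sets \<mu>" unfolding sets by (rule sigma_sets.Basic)
      then show "emeasure \<mu> C = emeasure (distr \<mu> \<mu> (T h)) C"
        using C h by (simp add: emeasure_distr[OF meas] pre em preimage_local_set mean_preimage)
    qed
    then have "emeasure \<mu> B = emeasure (distr \<mu> \<mu> (T h)) B" by simp
    also have "\<dots> = emeasure \<mu> {y \<in> Y. T h y \<in> B}"
      using emeasure_distr[OF meas B] pre by simp
    finally show ?thesis unfolding topspace_orbit_closure by simp
  qed
  then have "invariant_borel_prob G Ytop T \<mu>"
    unfolding invariant_borel_prob_def sets_borel_orbit_closure[OF countable_carrier]
    using prob sets by blast
  then show ?thesis by blast
qed

lemma uniquely_ergodic_orbit_closure: "uniquely_ergodic G Ytop T"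
proof -
  have "\<mu> = \<nu>" if \<mu>: "invariant_borel_prob G Ytop T \<mu>" and \<nu>: "invariant_borel_prob G Ytop T \<nu>" for \<mu> \<nu>
  proof (rule measure_eqI_local_sets)
    show p: "prob_space \<mu>" "sets \<mu> = sigma_sets Y local_sets" "sets \<nu> = sigma_sets Y local_sets"
      using \<mu> \<nu> sets_borel_orbit_closure[OF countable_carrier] unfolding invariant_borel_prob_def by auto
    have "prob_space \<nu>" using \<nu> unfolding invariant_borel_prob_def by blast
    then show "emeasure \<mu> C = emeasure \<nu> C" if "C \<in> local_sets" for C
      using invariant_measure_eq_mean[OF \<mu> that] invariant_measure_eq_mean[OF \<nu> that] p(1)
      by (simp add: finite_measure.emeasure_eq_measure prob_space.finite_measure)
  qed
  then show ?thesis unfolding uniquely_ergodic_def using invariant_measure_exists by blast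
qed

end

lemma (in shift_orbit) regular_uniquely_ergodic:
  assumes "countable (carrier G)" and reg: "regular_toeplitz G A x"
  shows "uniquely_ergodic G Ytop T"
proof -
  have "\<exists>D. \<exists>H P. approximate_period (coset_action H) D P (inverse (real (Suc n)))" for n
    using regular_approximate_period[OF reg, of "inverse (real (Suc n))"] by (metis inverse_positive_iff_positive of_nat_0_less_iff zero_less_Suc)
  then obtain D where D: "\<And>n. \<exists>H P. approximate_period (coset_action H) (D n) P (inverse (real (Suc n)))"
    by metis
  interpret averaging_orbit G A x D
  proof
    show "countable (carrier G)" by (rule assms(1))
    fix n :: nat
    show "finite (D n)" "D n \<noteq> {}" "D n \<subseteq> carrier G"
      using D[of n] approximate_period_finite by metis+
  next
    fix C assume "C \<in> local_sets"
    then obtain K where K: "finite K" "K \<subseteq> carrier G" "depends_on K C" by (rule local_setsE)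
    have "\<exists>\<alpha>. \<forall>h\<in>carrier G. \<forall>y\<in>Y. \<bar>freq (D n) h y C - \<alpha>\<bar> \<le> real (card K) * inverse (real (Suc n))" for n
      using D[of n] uniform_average[OF _ K] unfolding freq_def by blast
    then show "\<exists>c. \<forall>n. \<exists>\<alpha>. \<forall>h\<in>carrier G. \<forall>y\<in>Y. \<bar>freq (D n) h y C - \<alpha>\<bar> \<le> c * inverse (real (Suc n))"
      by blast
  qed
  show ?thesis by (rule uniquely_ergodic_orbit_closure)
qed

section \<open>Topological entropy\<close>

context shift_orbit
begin

text \<open>The analogue of a Lebesgue number: by compactness a single finite set \<open>K\<close> is fine enough for all
  points \<open>y\<close>. The points that share the pattern of \<open>y\<close> on \<open>K\<close> lie together in one member of the
  cover, and \<open>w\<close> makes a choice of it.\<close>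

lemma open_cover_lebesgue:
  assumes "open_cover Ytop \<U>"
  obtains K w where "finite K" "K \<subseteq> carrier G" "\<And>y. y \<in> Y \<Longrightarrow> w y \<in> \<U>"
    "\<And>y z. y \<in> Y \<Longrightarrow> z \<in> Y \<Longrightarrow> (\<And>k. k \<in> K \<Longrightarrow> z k = y k) \<Longrightarrow> z \<in> w y"
proof -
  have op: "\<And>U. U \<in> \<U> \<Longrightarrow> openin Ytop U" and un: "\<Union>\<U> = Y"
    using assms unfolding open_cover_def topspace_orbit_closure by auto
  define good where "good y U K \<longleftrightarrow> U \<in> \<U> \<and> finite K \<and> K \<subseteq> carrier G \<and>
      {z \<in> Y. \<forall>k\<in>K. z k = y k} \<subseteq> U" for y U K
  have "\<exists>U K. good y U K" if y: "y \<in> Y" for y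
  proof -
    obtain U where U: "U \<in> \<U>" "y \<in> U" using y un by blast
    obtain K where K: "finite K" "K \<subseteq> carrier G"
      "\<And>z. z \<in> Y \<Longrightarrow> (\<And>k. k \<in> K \<Longrightarrow> z k = y k) \<Longrightarrow> z \<in> U"
      using open_orbit_closure_contains_cylinder[OF op[OF U(1)] U(2)] by blast
    have "{z \<in> Y. \<forall>k\<in>K. z k = y k} \<subseteq> U" using K(3) by auto
    then show ?thesis using U K unfolding good_def by blast
  qed
  then obtain U K where UK: "\<And>y. y \<in> Y \<Longrightarrow> good y (U y) (K y)" by metis
  define Z where "Z y = {z \<in> Y. \<forall>k\<in>K y. z k = y k}" for y
  have Zop: "openin Ytop (Z y)" if y: "y \<in> Y" for y
  proof (rule openin_local_set, rule local_setsI[of "K y"])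
    show "finite (K y)" "K y \<subseteq> carrier G" using UK[OF y] unfolding good_def by auto
    show "depends_on (K y) (Z y)" by (rule depends_onI) (auto simp: Z_def)
  qed
  have "Y \<subseteq> \<Union>(Z ` Y)" unfolding Z_def by auto
  then obtain \<F> where \<F>: "finite \<F>" "\<F> \<subseteq> Z ` Y" "Y \<subseteq> \<Union>\<F>"
    using compact_orbit_closure[unfolded compact_space_alt topspace_orbit_closure,
        rule_format, of "Z ` Y"] Zop by auto
  obtain J where J: "J \<subseteq> Y" "finite J" "\<F> = Z ` J" using finite_subset_image[OF \<F>(1,2)] by blast
  have "\<exists>j\<in>J. y \<in> Z j" if "y \<in> Y" for y using that \<F>(3) J(3) by blast
  then obtain j where j: "\<And>y. y \<in> Y \<Longrightarrow> j y \<in> J \<and> y \<in> Z (j y)" by metis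
  show ?thesis
  proof (rule that[of "\<Union>i\<in>J. K i" "\<lambda>y. U (j y)"])
    show "finite (\<Union>i\<in>J. K i)" "(\<Union>i\<in>J. K i) \<subseteq> carrier G"
      using J UK unfolding good_def by blast+
    show "U (j y) \<in> \<U>" if "y \<in> Y" for y using j[OF that] J UK unfolding good_def by blast
    show "z \<in> U (j y)" if yz: "y \<in> Y" "z \<in> Y" "\<And>k. k \<in> (\<Union>i\<in>J. K i) \<Longrightarrow> z k = y k" for y z
    proof -
      have jy: "j y \<in> J" "y \<in> Z (j y)" using j[OF yz(1)] by auto
      have "z k = j y k" if "k \<in> K (j y)" for k
        using yz(3)[of k] jy that unfolding Z_def by auto
      then have "z \<in> {z \<in> Y. \<forall>k\<in>K (j y). z k = j y k}" using yz(2) by simp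
      moreover have "good (j y) (U (j y)) (K (j y))" using UK J jy by blast
      ultimately show ?thesis unfolding good_def by blast
    qed
  qed
qed

text \<open>The pattern of \<open>z\<close> on \<open>K F\<close> determines the patterns on \<open>K\<close> of all translates of \<open>z\<close> by elements of
  \<open>F\<close>. One member of the join for each pattern on \<open>K F\<close>, chosen through a representative point, thus
  suffices to cover the space.\<close>

lemma min_subcover_card_join_le:
  assumes F: "finite F" "F \<subseteq> carrier G" and K: "finite K" "K \<subseteq> carrier G"
    and w: "\<And>y. y \<in> Y \<Longrightarrow> w y \<in> \<U>"
      "\<And>y z. y \<in> Y \<Longrightarrow> z \<in> Y \<Longrightarrow> (\<And>k. k \<in> K \<Longrightarrow> z k = y k) \<Longrightarrow> z \<in> w y"
    and S: "S = (\<lambda>(k, f). k \<otimes> f) ` (K \<times> F)" and fin: "finite ((\<lambda>y. restrict y S) ` Y)"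
  shows "min_subcover_card Ytop (cover_join Ytop T F \<U>) \<le> card ((\<lambda>y. restrict y S) ` Y)"
proof -
  let ?R = "(\<lambda>y. restrict y S) ` Y"
  define rep where "rep = inv_into Y (\<lambda>y. restrict y S)"
  have rep: "rep r \<in> Y" "restrict (rep r) S = r" if "r \<in> ?R" for r
    unfolding rep_def using inv_into_into[OF that] f_inv_into_f[OF that] by auto
  define V where "V y = {z \<in> topspace Ytop. \<forall>f\<in>F. T f z \<in> w (T f y)}" for y
  let ?W = "(\<lambda>r. V (rep r)) ` ?R"
  have 1: "?W \<subseteq> cover_join Ytop T F \<U>"
  proof
    fix B assume "B \<in> ?W"
    then obtain r where r: "r \<in> ?R" "B = V (rep r)" by blast
    have "(\<lambda>f. w (T f (rep r))) \<in> F \<rightarrow> \<U>"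
      using w(1) shift_orbit_closure rep(1)[OF r(1)] F(2) by auto
    then show "B \<in> cover_join Ytop T F \<U>"
      unfolding cover_join_def r(2) V_def by (intro CollectI exI[of _ "\<lambda>f. w (T f (rep r))"] conjI refl)
  qed
  have "z \<in> \<Union>?W" if z: "z \<in> Y" for z
  proof -
    let ?r = "restrict z S"
    have r: "?r \<in> ?R" using z by blast
    have "T f z \<in> w (T f (rep ?r))" if f: "f \<in> F" for f
    proof (rule w(2))
      have fc: "f \<in> carrier G" using f F by blast
      show "T f (rep ?r) \<in> Y" "T f z \<in> Y" using shift_orbit_closure fc z rep(1)[OF r] by auto
      fix k assume k: "k \<in> K"
      then have "k \<otimes> f \<in> S" using f unfolding S by force
      then have "rep ?r (k \<otimes> f) = z (k \<otimes> f)" using fun_cong[OF rep(2)[OF r], of "k \<otimes> f"] by simp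
      then show "T f z k = T f (rep ?r) k" using k K(2) by (simp add: shift_apply subset_iff)
    qed
    then have "z \<in> V (rep ?r)" unfolding V_def topspace_orbit_closure using z by simp
    then show ?thesis using r by blast
  qed
  moreover have "\<Union>?W \<subseteq> Y" unfolding V_def topspace_orbit_closure by auto
  ultimately have 2: "\<Union>?W = topspace Ytop" unfolding topspace_orbit_closure by blast
  have "min_subcover_card Ytop (cover_join Ytop T F \<U>) \<le> card ?W"
    unfolding min_subcover_card_def
    by (rule Least_le, rule exI[of _ ?W]) (use 1 2 fin in simp)
  also have "\<dots> \<le> card ?R" by (rule card_image_le[OF fin])
  finally show ?thesis .
qed

text \<open>Once \<open>d\<close> is known, the letters at the positions \<open>s\<close> with \<open>s \<otimes> d \<in> P\<close> are forced and the others
  are arbitrary.\<close>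

lemma pattern_count:
  assumes ap: "approximate_period \<phi> D P \<epsilon>" and S: "finite S" "S \<subseteq> carrier G"
  shows "finite ((\<lambda>y. restrict y S) ` Y)"
    and "card ((\<lambda>y. restrict y S) ` Y) \<le> (\<Sum>d\<in>D. card A ^ card {s \<in> S. s \<otimes> d \<notin> P})"
proof -
  define Q where "Q d = Pi\<^sub>E S (\<lambda>s. if s \<otimes> d \<in> P then {x (s \<otimes> d)} else A)" for d
  have D: "finite D" using approximate_period_finite[OF ap] by blast
  have finQ: "finite (Q d)" for d
    unfolding Q_def using S finite_alphabet by (intro finite_PiE) auto
  have sub: "(\<lambda>y. restrict y S) ` Y \<subseteq> (\<Union>d\<in>D. Q d)"
  proof
    fix r assume "r \<in> (\<lambda>y. restrict y S) ` Y"
    then obtain y where y: "y \<in> Y" "r = restrict y S" by blast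
    obtain d where d: "d \<in> D" "\<And>h. h \<in> carrier G \<Longrightarrow> h \<otimes> d \<in> P \<Longrightarrow> y h = x (h \<otimes> d)"
      using orbit_closure_periodic_part[OF ap y(1)] by blast
    have "y s \<in> A" if "s \<in> S" for s using orbit_closure_config[OF y(1)] S(2) that by auto
    then have "r \<in> Q d" unfolding Q_def y(2) using d(2) S(2) by auto
    then show "r \<in> (\<Union>d\<in>D. Q d)" using d(1) by blast
  qed
  have finU: "finite (\<Union>d\<in>D. Q d)" using D finQ by blast
  show "finite ((\<lambda>y. restrict y S) ` Y)" by (rule finite_subset[OF sub finU])
  have cardQ: "card (Q d) = card A ^ card {s \<in> S. s \<otimes> d \<notin> P}" for d
  proof -
    have "card (Q d) = (\<Prod>s\<in>S. if s \<otimes> d \<in> P then 1 else card A)"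
      unfolding Q_def card_PiE[OF S(1)] by (intro prod.cong) auto
    also have "\<dots> = card A ^ card {s \<in> S. s \<otimes> d \<notin> P}"
      using S(1) by (simp add: prod.If_cases Int_def)
    finally show ?thesis .
  qed
  have "card ((\<lambda>y. restrict y S) ` Y) \<le> card (\<Union>d\<in>D. Q d)" by (rule card_mono[OF finU sub])
  also have "\<dots> \<le> (\<Sum>d\<in>D. card (Q d))" by (rule card_UN_le[OF D])
  finally show "card ((\<lambda>y. restrict y S) ` Y) \<le> (\<Sum>d\<in>D. card A ^ card {s \<in> S. s \<otimes> d \<notin> P})"
    unfolding cardQ .
qed

lemma log_subcover_card_le:
  assumes ap: "approximate_period \<phi> D P \<epsilon>"
    and F: "finite F" "F \<subseteq> carrier G" "F \<noteq> {}" and K: "finite K" "K \<subseteq> carrier G"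
    and w: "\<And>y. y \<in> Y \<Longrightarrow> w y \<in> \<U>"
      "\<And>y z. y \<in> Y \<Longrightarrow> z \<in> Y \<Longrightarrow> (\<And>k. k \<in> K \<Longrightarrow> z k = y k) \<Longrightarrow> z \<in> w y"
    and few: "\<And>k d. k \<in> K \<Longrightarrow> d \<in> D \<Longrightarrow> real (card {f \<in> F. k \<otimes> f \<otimes> d \<notin> P}) \<le> \<delta> * real (card F)"
  shows "ln (real (min_subcover_card Ytop (cover_join Ytop T F \<U>))) / real (card F)
    \<le> ln (real (card D)) / real (card F) + real (card K) * \<delta> * ln (real (card A))"
proof -
  define S where "S = (\<lambda>(k, f). k \<otimes> f) ` (K \<times> F)"
  have S: "finite S" "S \<subseteq> carrier G" unfolding S_def using F K by auto
  let ?N = "min_subcover_card Ytop (cover_join Ytop T F \<U>)"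
  note D = approximate_period_finite[OF ap]
  have cF: "real (card F) > 0" using F by (simp add: card_gt_0_iff)
  have "x \<one> \<in> A" using base_config by auto
  then have cA: "card A \<ge> 1" using finite_alphabet by (metis One_nat_def Suc_leI card_gt_0_iff empty_iff)
  let ?a = "ln (real (card A))"
  have a: "?a \<ge> 0" using cA by simp
  let ?b = "real (card K) * (\<delta> * real (card F))"
  have each: "real (card A ^ card {s \<in> S. s \<otimes> d \<notin> P}) \<le> exp (?b * ?a)" if d: "d \<in> D" for d
  proof -
    have "{s \<in> S. s \<otimes> d \<notin> P} \<subseteq> (\<Union>k\<in>K. (\<lambda>f. k \<otimes> f) ` {f \<in> F. k \<otimes> f \<otimes> d \<notin> P})"
      unfolding S_def by auto
    then have "card {s \<in> S. s \<otimes> d \<notin> P} \<le> card (\<Union>k\<in>K. (\<lambda>f. k \<otimes> f) ` {f \<in> F. k \<otimes> f \<otimes> d \<notin> P})"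
      using K F by (intro card_mono) auto
    also have "\<dots> \<le> (\<Sum>k\<in>K. card ((\<lambda>f. k \<otimes> f) ` {f \<in> F. k \<otimes> f \<otimes> d \<notin> P}))"
      by (rule card_UN_le[OF K(1)])
    also have "\<dots> \<le> (\<Sum>k\<in>K. card {f \<in> F. k \<otimes> f \<otimes> d \<notin> P})"
      using F by (intro sum_mono card_image_le) auto
    finally have "real (card {s \<in> S. s \<otimes> d \<notin> P}) \<le> (\<Sum>k\<in>K. real (card {f \<in> F. k \<otimes> f \<otimes> d \<notin> P}))"
      by (simp flip: of_nat_sum)
    also have "\<dots> \<le> (\<Sum>k\<in>K. \<delta> * real (card F))" by (intro sum_mono few d)
    finally have le: "real (card {s \<in> S. s \<otimes> d \<notin> P}) \<le> ?b" by simp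
    have "real (card A ^ card {s \<in> S. s \<otimes> d \<notin> P}) = exp (real (card {s \<in> S. s \<otimes> d \<notin> P}) * ?a)"
      using cA by (simp add: exp_of_nat_mult)
    also have "\<dots> \<le> exp (?b * ?a)" using mult_right_mono[OF le a] by simp
    finally show ?thesis .
  qed
  have "?N \<le> card ((\<lambda>y. restrict y S) ` Y)"
    by (rule min_subcover_card_join_le[OF F(1,2) K w S_def pattern_count(1)[OF ap S]])
  also have "\<dots> \<le> (\<Sum>d\<in>D. card A ^ card {s \<in> S. s \<otimes> d \<notin> P})"
    by (rule pattern_count(2)[OF ap S])
  finally have "real ?N \<le> real (\<Sum>d\<in>D. card A ^ card {s \<in> S. s \<otimes> d \<notin> P})"
    by (rule of_nat_mono)
  also have "\<dots> = (\<Sum>d\<in>D. real (card A ^ card {s \<in> S. s \<otimes> d \<notin> P}))" by (rule of_nat_sum)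
  also have "\<dots> \<le> (\<Sum>d\<in>D. exp (?b * ?a))" by (intro sum_mono each)
  finally have N: "real ?N \<le> real (card D) * exp (?b * ?a)" by simp
  have "ln (real ?N) \<le> ln (real (card D)) + ?b * ?a"
  \<comment> \<open>For an empty subcover the convention \<open>ln 0 = 0\<close> leaves a nonnegativity claim.\<close>
  proof (cases "?N = 0")
    case True
    have "0 \<le> ?b"
    proof (cases "K = {}")
      case False
      then obtain k where "k \<in> K" by blast
      moreover obtain d where "d \<in> D" using D by blast
      ultimately have "0 \<le> \<delta> * real (card F)" using few[of k d] by (meson of_nat_0_le_iff order_trans)
      then show ?thesis by simp
    qed simp
    then show ?thesis using True a D(4) by (simp add: Suc_leI)
  next
    case False
    then have "ln (real ?N) \<le> ln (real (card D) * exp (?b * ?a))" using N by simp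
    also have "\<dots> = ln (real (card D)) + ?b * ?a" using D(4) by (simp add: ln_mult)
    finally show ?thesis .
  qed
  then have "ln (real ?N) / real (card F) \<le> (ln (real (card D)) + ?b * ?a) / real (card F)"
    using cF by (intro divide_right_mono) auto
  also have "\<dots> = ln (real (card D)) / real (card F) + real (card K) * \<delta> * ?a"
    using cF by (simp add: field_simps)
  finally show ?thesis .
qed

text \<open>Divided by \<open>|F n|\<close>, the term \<open>ln |D|\<close> vanishes in the limit because \<open>F n\<close> grows, and the term for the
  free positions is made small by the choice of \<open>\<epsilon>\<close> before \<open>D\<close> is fixed.\<close>

lemma regular_cover_growth:
  assumes inf: "infinite (carrier G)" and reg: "regular_toeplitz G A x" and F: "folner_sequence G F"
    and \<U>: "open_cover Ytop \<U>"
  shows "(\<lambda>n. ln (real (min_subcover_card Ytop (cover_join Ytop T (F n) \<U>))) / real (card (F n))) \<longlonglongrightarrow> 0"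
    (is "?q \<longlonglongrightarrow> 0")
proof (rule tendstoI)
  fix e :: real assume e: "e > 0"
  obtain K w where K: "finite K" "K \<subseteq> carrier G" and w: "\<And>y. y \<in> Y \<Longrightarrow> w y \<in> \<U>"
      "\<And>y z. y \<in> Y \<Longrightarrow> z \<in> Y \<Longrightarrow> (\<And>k. k \<in> K \<Longrightarrow> z k = y k) \<Longrightarrow> z \<in> w y"
    using open_cover_lebesgue[OF \<U>] by blast
  have F1: "finite (F n)" "F n \<subseteq> carrier G" "F n \<noteq> {}" for n
    using F unfolding folner_sequence_def by auto
  define c where "c = real (card K) * ln (real (card A))"
  have "ln (real (card A)) \<ge> 0" by (cases "card A") auto
  then have c: "c \<ge> 0" unfolding c_def by simp
  \<comment> \<open>The free positions contribute \<open>2 * \<epsilon> * c\<close> in the limit; adding 1 to \<open>c\<close> covers the case \<open>c = 0\<close>.\<close>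
  define \<epsilon> where "\<epsilon> = e / (4 * (c + 1))"
  have \<epsilon>: "\<epsilon> > 0" unfolding \<epsilon>_def using e c by simp
  have c\<epsilon>: "c * (2 * \<epsilon>) \<le> e / 2"
    unfolding \<epsilon>_def using e c by (simp add: field_simps)
  obtain H D P where ap: "approximate_period (coset_action H) D P \<epsilon>"
    by (rule regular_approximate_period[OF reg \<epsilon>])
  note D = approximate_period_finite[OF ap]
  have "\<forall>\<^sub>F n in sequentially. \<forall>k\<in>K. \<forall>d\<in>D.
      real (card {f \<in> F n. k \<otimes> f \<otimes> d \<in> carrier G - P}) \<le> 2 * \<epsilon> * real (card (F n))"
  proof (intro eventually_ball_finite K(1) D(1) ballI)
    fix k d assume kd: "k \<in> K" "d \<in> D"
    have "{d \<in> D. d \<in> carrier G - P} = D - P" using D(3) by blast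
    then have le: "real (card {d \<in> D. d \<in> carrier G - P}) \<le> \<epsilon> * real (card D)"
      using ap unfolding approximate_period_def by simp
    show "\<forall>\<^sub>F n in sequentially.
      real (card {f \<in> F n. k \<otimes> f \<otimes> d \<in> carrier G - P}) \<le> 2 * \<epsilon> * real (card (F n))"
      by (rule folner_frequency_saturated[OF _ _ _ F _ _ le \<epsilon>])
         (use ap kd K D saturated_diff in \<open>auto simp: approximate_period_def\<close>)
  qed
  moreover have "\<forall>\<^sub>F n in sequentially. nat \<lceil>2 * ln (real (card D)) / e\<rceil> + 1 \<le> card (F n)"
    using folner_card_at_top[OF inf F] unfolding filterlim_at_top by blast
  ultimately show "\<forall>\<^sub>F n in sequentially. dist (?q n) 0 < e"
  proof eventually_elim
    case (elim n)
    have few: "real (card {f \<in> F n. k \<otimes> f \<otimes> d \<notin> P}) \<le> (2 * \<epsilon>) * real (card (F n))"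
      if "k \<in> K" "d \<in> D" for k d
    proof -
      have "{f \<in> F n. k \<otimes> f \<otimes> d \<notin> P} = {f \<in> F n. k \<otimes> f \<otimes> d \<in> carrier G - P}"
        using that F1[of n] K D by auto
      then show ?thesis using elim(1) that by simp
    qed
    have cF: "real (card (F n)) > 0" using F1 by (simp add: card_gt_0_iff)
    have "2 * ln (real (card D)) / e < real (card (F n))" using elim(2) by linarith
    then have "ln (real (card D)) / real (card (F n)) < e / 2"
      using e cF by (simp add: field_simps)
    moreover have "real (card K) * (2 * \<epsilon>) * ln (real (card A)) \<le> e / 2"
      using c\<epsilon> unfolding c_def by (simp add: mult_ac)
    moreover have "?q n \<le> ln (real (card D)) / real (card (F n))
        + real (card K) * (2 * \<epsilon>) * ln (real (card A))"
      by (rule log_subcover_card_le[where w = w, OF ap F1[of n] K w few])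
    ultimately have "?q n < e" by linarith
    moreover have "0 \<le> ln (real m)" for m by (cases m) auto
    then have "0 \<le> ?q n" by simp
    ultimately show ?case by simp
  qed
qed

lemma regular_topological_entropy_zero:
  assumes "infinite (carrier G)" and "regular_toeplitz G A x" and "folner_sequence G F"
  shows "topological_entropy Ytop T F = 0"
proof -
  have "lim (\<lambda>n. ereal (ln (real (min_subcover_card Ytop (cover_join Ytop T (F n) \<U>))) / real (card (F n)))) = 0"
    if "open_cover Ytop \<U>" for \<U>
    using tendsto_ereal[OF regular_cover_growth[OF assms that]] by (intro limI) (simp add: zero_ereal_def)
  moreover have "open_cover Ytop {topspace Ytop}" unfolding open_cover_def by simp
  ultimately show ?thesis unfolding topological_entropy_def
    by (intro SUP_eq_const) auto
qed

end

theorem corollary51: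
  fixes G :: "('g, 'b) monoid_scheme" and A :: "'a set" and x :: "'g \<Rightarrow> 'a"
  assumes "group G" and "countable (carrier G)" and "infinite (carrier G)"
    and "amenable G" and "residually_finite G"
    and "finite A"
    and "regular_toeplitz G A x"
  shows "uniquely_ergodic G (orbit_closure_topology G A x) (shift G) \<and>
    (\<forall>F. folner_sequence G F \<longrightarrow>
       topological_entropy (orbit_closure_topology G A x) (shift G) F = 0)"
proof -
  interpret group G by (rule assms(1))
  interpret shift_orbit G A x
    using assms(6,7) unfolding regular_toeplitz_def toeplitz_def by unfold_locales auto
  show ?thesis
    using regular_uniquely_ergodic regular_topological_entropy_zero assms(2,3,7) by blast
qed

end
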